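(* Let $\ell\ge 3$ be a constant integer, let $\emptyset\neq\mathcal{S}\subseteq\mathbf{S}_\ell$, and let $q=q(n)\in(0,1)$ be such that, as $n\to\infty$, $$n^{-\frac{3}{2(\ell-1)}}=o(1-q)\quad\text{and}\quad 1-q=o\left((\ln n)^{-\frac{1}{\ell-2}}\right).$$ Let $\Pi_n\sim\mathrm{Mallows}(n,q)$ and $\lambda_n=\mathbb{E}\,\mathrm{Arr}_{\mathcal{S}}(\Pi_n)$. Then $$d_{TV}\left(\mathrm{Arr}_{\mathcal{S}}(\Pi_n),\mathrm{Po}(\lambda_n)\right)=o(1).$$
   Context: All asymptotics are as $n\to\infty$. $[t]=\{1,\ldots,t\}$ and $\mathbf{S}_t$ is the set of permutations of $[t]$. Mallows distribution: $\mathrm{Mallows}(n,q)$ is the law of a random permutation $\Pi_n\in\mathbf{S}_n$ with $\mathbb{P}(\Pi_n=\sigma)=q^{\mathrm{inv}(\sigma)}/\sum_{\pi\in\mathbf{S}_n}q^{\mathrm{inv}(\pi)}$, where $\mathrm{inv}(\sigma)=|\{(i,j):1\le i<j\le n,\ \sigma(i)>\sigma(j)\}|$. $\mathcal{S}$-arrangements: for $\emptyset\ne\mathcal{S}\subseteq\mathbf{S}_\ell$, $n\ge\ell$ and $0\le k_1,k_2\le n-\ell$, there is an $(\mathcal{S},k_1,k_2)$-arrangement in a permutation $\Pi_n\in\mathbf{S}_n$ if there is $\sigma\in\mathcal{S}$ with $\Pi_n(k_2+i)=k_1+\sigma(i)$ for all $i\in[\ell]$. $\mathrm{Arr}_{\mathcal{S}}(\Pi_n)$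 is the number of pairs $(k_1,k_2)$ such that there is an $(\mathcal{S},k_1,k_2)$-arrangement in $\Pi_n$. $\mathrm{Po}(\eta)$ is the Poisson distribution with parameter $\eta$. For random variables $X,Y$ with values in $\mathbb{N}_0=\{0,1,2,\ldots\}$, $d_{TV}(X,Y)=\max_{A\subseteq\mathbb{N}_0}|\mathbb{P}(X\in A)-\mathbb{P}(Y\in A)|$ (a law may be written in place of a random variable with that law). *)

theory Defs
  imports
    "HOL-Probability.Probability"
    "HOL-Combinatorics.Permutations"
    "HOL-Library.Landau_Symbols"
begin

definition perms :: "nat \<Rightarrow> (nat \<Rightarrow> nat) set" where
  "perms t = {\<sigma>. \<sigma> permutes {1..t}}"

definition inv_count :: "nat \<Rightarrow> (nat \<Rightarrow> nat) \<Rightarrow> nat" where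
  "inv_count n \<sigma> = card {(i, j). 1 \<le> i \<and> i < j \<and> j \<le> n \<and> \<sigma> i > \<sigma> j}"

text \<open>Only meaningful for \<open>q > 0\<close>, see \<open>pmf_mallows\<close> below.\<close>

definition mallows :: "nat \<Rightarrow> real \<Rightarrow> (nat \<Rightarrow> nat) pmf" where
  "mallows n q = embed_pmf (\<lambda>\<sigma>. if \<sigma> \<in> perms n
      then q ^ inv_count n \<sigma> / (\<Sum>\<pi>\<in>perms n. q ^ inv_count n \<pi>) else 0)"

definition has_arrangement ::
    "nat \<Rightarrow> (nat \<Rightarrow> nat) set \<Rightarrow> nat \<Rightarrow> nat \<Rightarrow> (nat \<Rightarrow> nat) \<Rightarrow> bool" where
  "has_arrangement l S k1 k2 \<pi> \<longleftrightarrow> (\<exists>\<sigma>\<in>S. \<forall>i\<in>{1..l}. \<pi> (k2 + i) = k1 + \<sigma> i)"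

text \<open>The range condition \<open>0 \<le> k1, k2 \<le> n - l\<close> is written without truncated subtraction.\<close>

definition Arr :: "nat \<Rightarrow> nat \<Rightarrow> (nat \<Rightarrow> nat) set \<Rightarrow> (nat \<Rightarrow> nat) \<Rightarrow> nat" where
  "Arr n l S \<pi> = card {(k1, k2). k1 + l \<le> n \<and> k2 + l \<le> n \<and> has_arrangement l S k1 k2 \<pi>}"

text \<open>Total variation distance between two laws on the natural numbers; the maximum over all
  events is written as a supremum, since \<^const>\<open>Max\<close> applies to finite sets only.\<close>

definition tv_dist :: "nat pmf \<Rightarrow> nat pmf \<Rightarrow> real" where
  "tv_dist X Y = (SUP A. \<bar>measure_pmf.prob X A - measure_pmf.prob Y A\<bar>)"

lemma finite_perms: "finite (perms n)"
  unfolding perms_def by (simp add: finite_permutations)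

lemma pmf_mallows:
  assumes "q > 0"
  shows "pmf (mallows n q) \<sigma> = (if \<sigma> \<in> perms n
      then q ^ inv_count n \<sigma> / (\<Sum>\<pi>\<in>perms n. q ^ inv_count n \<pi>) else 0)"
proof -
  let ?Z = "\<Sum>\<pi>\<in>perms n. q ^ inv_count n \<pi>"
  let ?f = "\<lambda>\<sigma>. if \<sigma> \<in> perms n then q ^ inv_count n \<sigma> / ?Z else 0"
  have "id \<in> perms n"
    by (simp add: perms_def permutes_id)
  then have Z: "?Z > 0"
    using assms finite_perms by (intro sum_pos) auto
  have nonneg: "?f \<pi> \<ge> 0" for \<pi>
    using assms Z by simp
  have "(\<integral>\<^sup>+\<pi>. ennreal (?f \<pi>) \<partial>count_space UNIV) = (\<Sum>\<pi>\<in>perms n. ennreal (?f \<pi>))"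
    by (rule nn_integral_count_space'[OF finite_perms]) auto
  also have "\<dots> = ennreal (\<Sum>\<pi>\<in>perms n. ?f \<pi>)"
    by (rule sum_ennreal) (rule nonneg)
  also have "(\<Sum>\<pi>\<in>perms n. ?f \<pi>) = (\<Sum>\<pi>\<in>perms n. q ^ inv_count n \<pi> / ?Z)"
    by (intro sum.cong) auto
  also have "\<dots> = 1"
    using Z by (simp flip: sum_divide_distrib)
  finally show ?thesis
    unfolding mallows_def using nonneg by (subst pmf_embed_pmf) auto
qed

end

theory Submission
  imports Defs "HOL-Real_Asymp.Real_Asymp"
begin

text \<open>Reading a permutation from left to right, let \<open>c t\<close> be the number of earlier entries that exceed the
entry at position \<open>t\<close>. Under the Mallows law these inversion codes are independent, \<open>c t\<close> being
geometric with parameter \<open>q\<close> truncated to \<open>{0..<t}\<close> (\<open>map_code_mallows\<close>). Everything is expressed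
in the codes through \<open>rank_at c j t\<close>, the number of entries among the first \<open>t\<close> that exceed the
\<open>j\<close>-th one: it starts at \<open>c j\<close>, and the entry inserted at time \<open>Suc t\<close> raises it by one exactly if
\<open>c (Suc t) \<le> rank_at c j t\<close>. An arrangement at position \<open>k\<close> means that at time \<open>n\<close> the \<open>l\<close> ranks of
the positions \<open>k + 1, \<dots>, k + l\<close> are consecutive and ordered by a pattern in \<open>S\<close>. For given \<open>k\<close> there
is at most one \<open>k1\<close>, so \<open>Arr\<close> is a sum of indicators \<open>I k\<close> over \<open>k \<le> n - l\<close>
(\<open>Arr_eq_card_blocks\<close>).

Write \<open>\<epsilon> = 1 - q\<close>. A block of consecutive ranks can only be destroyed at time \<open>Suc t\<close> if
\<open>c (Suc t)\<close> exceeds one of its ranks. Ranks grow so fast that this is unlikely after a time of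
order \<open>ln n / \<epsilon>\<close>: the expectation of \<open>x / (1 - x)\<close> at \<open>x = q ^ (rank + 1)\<close> shrinks at least by the
factor \<open>1 - \<epsilon>/2\<close> per step (\<open>expectation_potential_rank_at\<close>). Hence with \<open>m\<close> about \<open>10 ln n / \<epsilon>\<close> the indicator \<open>I k\<close>
agrees, up to a polynomially small error, with \<open>J k\<close>, the same event evaluated at time \<open>k + l + m\<close>
or \<open>n\<close>, whichever is earlier (\<open>prob_block_changes\<close>). Now \<open>J k\<close> depends only on the \<open>l + m\<close> independent codes after \<open>k\<close>, so the
\<open>J k\<close> are exactly locally dependent and the Stein-Chen method applies (\<open>stein_chen_local\<close>), with the
classical bound \<open>1 / \<lambda>\<close> on the increments of the solution of the Stein equation
(\<open>stein_sol_lipschitz\<close>).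

The sizes are as follows. A block forces its \<open>l\<close> codes to be within distance \<open>2 l\<close> of each other,
which gives \<open>P (J k) = O(\<epsilon> ^ (l - 1))\<close>, while two overlapping blocks force \<open>l + 1\<close> codes to be
close and cost \<open>O(\<epsilon> ^ l)\<close>. Conversely \<open>\<lambda> \<ge> c n \<epsilon> ^ (l - 1)\<close>, because the probability that a block
survives has an explicit harmonic function (\<open>expectation_survival_step\<close>). So the Stein-Chen error
is of order \<open>(n m \<epsilon> ^ (2 (l - 1)) + n \<epsilon> ^ l) / (n \<epsilon> ^ (l - 1)) = m \<epsilon> ^ (l - 1) + \<epsilon>\<close>, and
\<open>m \<epsilon> ^ (l - 1)\<close> is of order \<open>\<epsilon> ^ (l - 2) ln n\<close>, which is the quantity that the upper bound on \<open>\<epsilon>\<close>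
sends to zero. For the first \<open>m\<close> positions the truncation of the geometric law is felt; they are
discarded, at a cost \<open>m \<epsilon> ^ (l - 1)\<close> again, which is seen by reversing the permutation
(\<open>prob_block_le_reversed\<close>). The discarded mass \<open>\<delta>\<close> also shifts the mean, at a cost of order
\<open>\<delta> / \<lambda>\<close>; this is harmless unless \<open>\<lambda> \<le> sqrt \<delta>\<close>, and then both laws are close to the point mass at 0
(\<open>poisson_approximation\<close>).\<close>

section \<open>The Stein equation for the Poisson law\<close>

text \<open>The solution \<open>g\<close> of \<open>r * g (k + 1) - k * g k = 1\<^sub>A(k) - P(A)\<close>. The usual denominator
\<open>r * pmf (k - 1)\<close> is written as \<open>k * pmf k\<close>; division by zero then yields the value 0 at \<open>k = 0\<close>,
so that the Lipschitz bound extends down to 0 and controls the growth of \<open>g\<close> itself.\<close>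

definition stein_sol :: "real \<Rightarrow> nat set \<Rightarrow> nat \<Rightarrow> real" where
  "stein_sol r A k =
     (measure_pmf.prob (poisson_pmf r) (A \<inter> {..<k}) -
        measure_pmf.prob (poisson_pmf r) A * measure_pmf.prob (poisson_pmf r) {..<k}) /
     (real k * pmf (poisson_pmf r) k)"

lemma poisson_pmf_Suc:
  assumes "r > 0"
  shows "real (Suc k) * pmf (poisson_pmf r) (Suc k) = r * pmf (poisson_pmf r) k"
  using assms by (simp add: field_simps del: of_nat_Suc)

lemma prob_poisson_pos: "r > 0 \<Longrightarrow> pmf (poisson_pmf r) k > 0"
  by (simp add: pmf_positive)

lemma prob_pmf_lessThan_Suc_Int:
  fixes p :: "nat pmf"
  shows "measure_pmf.prob p (A \<inter> {..<Suc k}) = measure_pmf.prob p (A \<inter> {..<k}) + indicator A k * pmf p k"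
proof (cases "k \<in> A")
  case True
  then have "A \<inter> {..<Suc k} = (A \<inter> {..<k}) \<union> {k}" by auto
  then show ?thesis
    using True by (subst \<open>A \<inter> {..<Suc k} = _\<close>, subst measure_pmf.finite_measure_Union) (auto simp: measure_pmf_single)
next
  case False
  then have "A \<inter> {..<Suc k} = A \<inter> {..<k}" by (auto simp: less_Suc_eq)
  then show ?thesis using False by simp
qed

lemma stein_sol_equation:
  assumes "r > 0"
  shows "r * stein_sol r A (Suc k) - real k * stein_sol r A k =
         indicator A k - measure_pmf.prob (poisson_pmf r) A"
proof -
  let ?p = "poisson_pmf r"
  define m where "m k = measure_pmf.prob ?p (A \<inter> {..<k}) -
        measure_pmf.prob ?p A * measure_pmf.prob ?p {..<k}" for k
  have pk: "pmf ?p k > 0" by (rule prob_poisson_pos[OF assms])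
  have "r * stein_sol r A (Suc k) = m (Suc k) / pmf ?p k"
    unfolding stein_sol_def m_def[symmetric] poisson_pmf_Suc[OF assms] using assms by simp
  moreover have "real k * stein_sol r A k = m k / pmf ?p k"
    unfolding stein_sol_def m_def[symmetric] by (cases "k = 0") (auto simp: m_def)
  moreover have "m (Suc k) - m k = (indicator A k - measure_pmf.prob ?p A) * pmf ?p k"
    unfolding m_def using prob_pmf_lessThan_Suc_Int[of ?p A k] prob_pmf_lessThan_Suc_Int[of ?p UNIV k]
    by (simp add: algebra_simps)
  ultimately show ?thesis using pk by (simp add: diff_divide_distrib[symmetric])
qed

text \<open>This bound and the next one compare \<open>k\<close> with the index \<open>i\<close> in \<open>i * pmf i = r * pmf (i - 1)\<close>, summed
over a tail or an initial segment.\<close>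

lemma poisson_tail_le:
  assumes "r > 0"
  shows "real k * measure_pmf.prob (poisson_pmf r) {k<..} \<le> r * measure_pmf.prob (poisson_pmf r) {k..}"
proof -
  let ?p = "poisson_pmf r"
  have tail: "(\<lambda>i. pmf ?p (i + j)) sums measure_pmf.prob ?p {j..}" for j
  proof -
    have "(\<lambda>i. measure_pmf.prob ?p {i + j}) sums measure_pmf.prob ?p (\<Union>i. {i + j})"
      by (rule measure_pmf.finite_measure_UNION) (auto simp: disjoint_family_on_def)
    moreover have "(\<Union>i. {i + j}) = {j..}" by (auto intro: le_add_diff_inverse2[symmetric])
    ultimately show ?thesis by (simp add: measure_pmf_single)
  qed
  have eq: "{k<..} = {Suc k..}" by auto
  have "(\<lambda>i. real k * pmf ?p (i + Suc k)) sums (real k * measure_pmf.prob ?p {k<..})"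
    unfolding eq by (intro sums_mult tail)
  moreover have "(\<lambda>i. r * pmf ?p (i + k)) sums (r * measure_pmf.prob ?p {k..})"
    by (intro sums_mult tail)
  moreover have "real k * pmf ?p (i + Suc k) \<le> r * pmf ?p (i + k)" for i
  proof -
    have "real k * pmf ?p (i + Suc k) \<le> real (Suc (i + k)) * pmf ?p (Suc (i + k))"
      by (simp del: pmf_poisson add: mult_right_mono)
    then show ?thesis by (simp only: poisson_pmf_Suc[OF assms])
  qed
  ultimately show ?thesis by (rule sums_le[rotated])
qed

lemma poisson_head_le:
  assumes "r > 0"
  shows "r * measure_pmf.prob (poisson_pmf r) {..<k} \<le> real k * measure_pmf.prob (poisson_pmf r) {..k}"
proof -
  let ?p = "poisson_pmf r"
  have "r * measure_pmf.prob ?p {..<k} = (\<Sum>i<k. r * pmf ?p i)"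
    by (simp add: measure_measure_pmf_finite sum_distrib_left del: pmf_poisson)
  also have "\<dots> = (\<Sum>i<k. real (Suc i) * pmf ?p (Suc i))"
    by (simp only: poisson_pmf_Suc[OF assms])
  also have "\<dots> \<le> (\<Sum>i<k. real k * pmf ?p (Suc i))"
    by (intro sum_mono mult_right_mono) auto
  also have "\<dots> = real k * (\<Sum>i\<in>Suc ` {..<k}. pmf ?p i)"
    by (simp add: sum.reindex sum_distrib_left del: pmf_poisson)
  also have "(\<Sum>i\<in>Suc ` {..<k}. pmf ?p i) \<le> (\<Sum>i\<in>{..k}. pmf ?p i)"
    by (intro sum_mono2) auto
  finally show ?thesis by (simp add: measure_measure_pmf_finite mult_left_mono del: pmf_poisson)
qed

lemma stein_sol_Compl: "stein_sol r (- A) k = - stein_sol r A k"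
proof -
  let ?p = "poisson_pmf r"
  have "measure_pmf.prob ?p {..<k} = measure_pmf.prob ?p ((A \<inter> {..<k}) \<union> (- A \<inter> {..<k}))"
    by (rule arg_cong[where f = "measure_pmf.prob ?p"]) auto
  also have "\<dots> = measure_pmf.prob ?p (A \<inter> {..<k}) + measure_pmf.prob ?p (- A \<inter> {..<k})"
    by (rule measure_pmf.finite_measure_Union) auto
  finally have "measure_pmf.prob ?p (- A \<inter> {..<k}) - measure_pmf.prob ?p (- A) * measure_pmf.prob ?p {..<k}
      = - (measure_pmf.prob ?p (A \<inter> {..<k}) - measure_pmf.prob ?p A * measure_pmf.prob ?p {..<k})"
    using measure_pmf.prob_compl[of A ?p] by (simp add: Compl_eq_Diff_UNIV ring_distribs)
  then show ?thesis unfolding stein_sol_def by (metis minus_divide_left)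
qed

text \<open>Split \<open>A\<close> into its parts below, at and above \<open>k\<close>. The increment is linear in the masses of the
three parts; by the two preceding bounds only the part at \<open>k\<close> has a positive coefficient.\<close>

lemma stein_sol_increment_le:
  assumes r: "r > 0"
  shows "stein_sol r A (Suc k) - stein_sol r A k \<le> 1 / r"
proof (cases "k = 0")
  case True
  have "stein_sol r A (Suc 0) = (indicator A 0 - measure_pmf.prob (poisson_pmf r) A) / r"
    using stein_sol_equation[OF r, of A 0] r by (simp add: field_simps)
  also have "\<dots> \<le> 1 / r"
    using r by (intro divide_right_mono) (auto simp: indicator_def add_nonneg_nonneg intro: order.trans[of _ 0])
  finally show ?thesis using True by (simp add: stein_sol_def)
next
  case False
  let ?p = "poisson_pmf r"
  let ?P = "measure_pmf.prob ?p"
  define \<pi> where "\<pi> = pmf ?p k"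
  have \<pi>: "\<pi> > 0" unfolding \<pi>_def by (rule prob_poisson_pos[OF r])
  define a b d S T where "a = ?P (A \<inter> {..<k})" and "b = indicator A k * \<pi>"
    and "d = ?P (A \<inter> {k<..})" and "S = ?P {..<k}" and "T = ?P {k<..}"
  have b: "0 \<le> b" "b \<le> \<pi>" using \<pi> by (auto simp: b_def indicator_def)
  have Sk: "?P {..<Suc k} = S + \<pi>"
    using prob_pmf_lessThan_Suc_Int[of ?p UNIV k] by (simp add: S_def \<pi>_def del: pmf_poisson)
  have "?P UNIV = ?P ({..<Suc k} \<union> {k<..})"
    by (rule arg_cong[where f = ?P]) auto
  also have "\<dots> = ?P {..<Suc k} + ?P {k<..}"
    by (rule measure_pmf.finite_measure_Union) auto
  finally have STp: "S + \<pi> + T = 1" using Sk by (simp add: T_def)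
  have ak: "?P (A \<inter> {..<Suc k}) = a + b"
    by (simp only: prob_pmf_lessThan_Suc_Int a_def b_def \<pi>_def)
  have "?P A = ?P ((A \<inter> {..<Suc k}) \<union> (A \<inter> {k<..}))"
    by (rule arg_cong[where f = ?P]) auto
  also have "\<dots> = ?P (A \<inter> {..<Suc k}) + ?P (A \<inter> {k<..})"
    by (rule measure_pmf.finite_measure_Union) auto
  finally have PA: "?P A = a + b + d" using ak by (simp add: d_def)
  have k0: "real k > 0" using False by simp
  have "?P {k..} = ?P ({k} \<union> {k<..})"
    by (rule arg_cong[where f = ?P]) auto
  also have "\<dots> = \<pi> + T"
    by (subst measure_pmf.finite_measure_Union) (auto simp: measure_pmf_single \<pi>_def T_def)
  finally have tl: "real k * T \<le> r * (\<pi> + T)" using poisson_tail_le[OF r, of k] by (simp add: T_def)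
  have hd: "r * S \<le> real k * (S + \<pi>)"
    using poisson_head_le[OF r, of k] Sk by (simp add: S_def lessThan_Suc_atMost)
  have e1: "stein_sol r A (Suc k) = ((a + b) - (a + b + d) * (S + \<pi>)) / (r * \<pi>)"
    unfolding stein_sol_def poisson_pmf_Suc[OF r] by (simp only: ak PA Sk \<pi>_def)
  have e2: "stein_sol r A k = (a - (a + b + d) * S) / (real k * \<pi>)"
    unfolding stein_sol_def by (simp only: a_def[symmetric] PA S_def[symmetric] \<pi>_def)
  have T: "T = 1 - S - \<pi>" using STp by simp
  have c1: "T / r \<le> (\<pi> + T) / k" using tl k0 r by (simp add: field_simps)
  have c2: "S / k \<le> (S + \<pi>) / r" using hd k0 r by (simp add: field_simps)
  have c3: "T / r + S / k \<le> 1 / r"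
  proof -
    have "T / r + S / k \<le> T / r + (S + \<pi>) / r" using c2 by simp
    also have "\<dots> = 1 / r" unfolding T by (simp add: add_divide_distrib[symmetric])
    finally show ?thesis .
  qed
  have "(stein_sol r A (Suc k) - stein_sol r A k) * \<pi> =
      ((a + b) - (a + b + d) * (S + \<pi>)) / r - (a - (a + b + d) * S) / k"
    unfolding e1 e2 using \<pi> r k0 by (simp add: field_simps)
  also have "\<dots> = a * (T / r - (\<pi> + T) / k) + b * (T / r + S / k) + d * (S / k - (S + \<pi>) / r)"
    unfolding T using r k0 by (simp add: field_simps)
  also have "\<dots> \<le> 0 + b * (1 / r) + 0"
    using c1 c2 c3 b by (intro add_mono mult_left_mono mult_nonneg_nonpos) (auto simp: a_def d_def)
  also have "\<dots> \<le> (1 / r) * \<pi>" using b r by (simp add: field_simps)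
  finally show ?thesis using \<pi> by (simp only: mult_le_cancel_right_pos)
qed

text \<open>The lower bound is the upper bound for the complement of \<open>A\<close>.\<close>

lemma stein_sol_lipschitz:
  assumes r: "r > 0"
  shows "\<bar>stein_sol r A (Suc k) - stein_sol r A k\<bar> \<le> 1 / r"
  using stein_sol_increment_le[OF r, of A k] stein_sol_increment_le[OF r, of "- A" k]
  by (simp add: stein_sol_Compl abs_le_iff)

lemma unit_steps_lipschitz:
  fixes g :: "nat \<Rightarrow> real"
  assumes "\<And>k. \<bar>g (Suc k) - g k\<bar> \<le> c"
  shows "\<bar>g (a + j) - g a\<bar> \<le> c * real j"
proof (induction j)
  case (Suc j)
  then show ?case using assms[of "a + j"] by (simp add: algebra_simps)
qed simp

section \<open>Local dependence\<close>

lemma expectation_of_bool: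
  "measure_pmf.expectation M (\<lambda>x. of_bool (Q x)) = measure_pmf.prob M {x. Q x}"
proof -
  have "measure_pmf.expectation M (\<lambda>x. of_bool (Q x)) = measure_pmf.expectation M (indicator {x. Q x} :: _ \<Rightarrow> real)"
    by (rule Bochner_Integration.integral_cong) (auto simp: indicator_def)
  then show ?thesis by simp
qed

text \<open>Compare \<open>W\<close> with \<open>V k\<close>, the sum over the indices outside the neighbourhood \<open>N k\<close>, which is
independent of \<open>I k\<close>: then \<open>E (I k * g (V k + 1))\<close> cancels against \<open>p k * E (g (V k + 1))\<close>, and the
rest is paid by the Lipschitz constant times the number of indices in \<open>N k\<close> that occur.\<close>

lemma stein_chen_local:
  fixes M :: "'a pmf" and I :: "'i \<Rightarrow> 'a \<Rightarrow> bool" and N :: "'i \<Rightarrow> 'i set" and g :: "nat \<Rightarrow> real"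
  assumes fin: "finite (set_pmf M)" and K: "finite K"
    and self: "\<And>k. k \<in> K \<Longrightarrow> k \<in> N k"
    and indep: "\<And>k \<phi>. k \<in> K \<Longrightarrow>
      measure_pmf.expectation M (\<lambda>x. of_bool (I k x) * \<phi> (card {j \<in> K - N k. I j x})) =
      measure_pmf.prob M {x. I k x} * measure_pmf.expectation M (\<lambda>x. \<phi> (card {j \<in> K - N k. I j x}) :: real)"
    and lip: "\<And>k. \<bar>g (Suc k) - g k\<bar> \<le> c"
  defines "W \<equiv> \<lambda>x. card {j \<in> K. I j x}"
    and "p \<equiv> \<lambda>k. measure_pmf.prob M {x. I k x}"
  shows "\<bar>measure_pmf.expectation M (\<lambda>x. (\<Sum>k\<in>K. p k) * g (W x + 1) - real (W x) * g (W x))\<bar>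
    \<le> c * (\<Sum>k\<in>K. (\<Sum>j\<in>K \<inter> N k. p k * p j) +
        (\<Sum>j\<in>K \<inter> N k - {k}. measure_pmf.prob M {x. I k x \<and> I j x}))"
proof -
  let ?E = "measure_pmf.expectation M"
  define V where "V k x = card {j \<in> K - N k. I j x}" for k x
  define U where "U k x = card {j \<in> K \<inter> N k - {k}. I j x}" for k x
  have [simp]: "integrable (measure_pmf M) f" for f :: "'a \<Rightarrow> real"
    using fin by (rule integrable_measure_pmf_finite)
  have c0: "c \<ge> 0" using lip[of 0] by linarith
  have card_sum: "real (card {j \<in> J. I j x}) = (\<Sum>j\<in>J. of_bool (I j x))" if "finite J" for J x
    using that by (simp add: Int_def)
  have W1: "W x = V k x + card {j \<in> K \<inter> N k. I j x}" if "k \<in> K" for k x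
  proof -
    have "{j \<in> K. I j x} = {j \<in> K - N k. I j x} \<union> {j \<in> K \<inter> N k. I j x}" by auto
    then show ?thesis unfolding W_def V_def using K by (simp add: card_Un_disjoint disjoint_iff)
  qed
  have W2: "W x = V k x + 1 + U k x" if "k \<in> K" "I k x" for k x
  proof -
    have "{j \<in> K \<inter> N k. I j x} = insert k {j \<in> K \<inter> N k - {k}. I j x}" using that self by auto
    then have "card {j \<in> K \<inter> N k. I j x} = 1 + U k x"
      unfolding U_def using K by simp
    then show ?thesis using W1[OF that(1)] by simp
  qed
  have b1: "\<bar>g (W x + 1) - g (V k x + 1)\<bar> \<le> c * (\<Sum>j\<in>K \<inter> N k. of_bool (I j x))" if "k \<in> K" for k x
    using unit_steps_lipschitz[where g = g and c = c, OF lip, of "V k x + 1" "card {j \<in> K \<inter> N k. I j x}"] W1[OF that, of x]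
      card_sum[of "K \<inter> N k" x] K by (simp add: add_ac)
  have b2: "\<bar>of_bool (I k x) * (g (W x) - g (V k x + 1))\<bar>
      \<le> c * (\<Sum>j\<in>K \<inter> N k - {k}. of_bool (I k x \<and> I j x))" if "k \<in> K" for k x
  proof (cases "I k x")
    case True
    then show ?thesis
      using unit_steps_lipschitz[where g = g and c = c, OF lip, of "V k x + 1" "U k x"] W2[OF that True]
        card_sum[of "K \<inter> N k - {k}" x] K by (simp add: U_def)
  qed simp
  have "?E (\<lambda>x. (\<Sum>k\<in>K. p k) * g (W x + 1) - real (W x) * g (W x))
      = ?E (\<lambda>x. \<Sum>k\<in>K. p k * g (W x + 1) - of_bool (I k x) * g (W x))"
    unfolding sum_subtractf sum_distrib_right[symmetric] W_def card_sum[OF K] ..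
  also have "\<dots> = (\<Sum>k\<in>K. ?E (\<lambda>x. p k * g (W x + 1) - of_bool (I k x) * g (W x)))"
    by (rule Bochner_Integration.integral_sum) simp
  also have "\<dots> = (\<Sum>k\<in>K. ?E (\<lambda>x. p k * (g (W x + 1) - g (V k x + 1))) -
      ?E (\<lambda>x. of_bool (I k x) * (g (W x) - g (V k x + 1))))"
  proof (rule sum.cong[OF refl])
    fix k assume k: "k \<in> K"
    have "?E (\<lambda>x. of_bool (I k x) * g (V k x + 1)) = p k * ?E (\<lambda>x. g (V k x + 1))"
      using indep[OF k, of "\<lambda>v. g (v + 1)"] by (simp add: V_def p_def)
    then show "?E (\<lambda>x. p k * g (W x + 1) - of_bool (I k x) * g (W x)) =
      ?E (\<lambda>x. p k * (g (W x + 1) - g (V k x + 1))) - ?E (\<lambda>x. of_bool (I k x) * (g (W x) - g (V k x + 1)))"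
      by (simp add: right_diff_distrib)
  qed
  also have "\<bar>\<dots>\<bar> \<le> (\<Sum>k\<in>K. c * ((\<Sum>j\<in>K \<inter> N k. p k * p j) +
        (\<Sum>j\<in>K \<inter> N k - {k}. measure_pmf.prob M {x. I k x \<and> I j x})))"
  proof (rule order.trans[OF sum_abs sum_mono])
    fix k assume k: "k \<in> K"
    have pk: "p k \<ge> 0" by (simp add: p_def)
    have "\<bar>?E (\<lambda>x. p k * (g (W x + 1) - g (V k x + 1)))\<bar>
        \<le> ?E (\<lambda>x. \<bar>p k * (g (W x + 1) - g (V k x + 1))\<bar>)"
      by (rule integral_abs_bound)
    also have "\<dots> \<le> ?E (\<lambda>x. p k * (c * (\<Sum>j\<in>K \<inter> N k. of_bool (I j x))))"
      using b1[OF k] pk by (intro integral_mono) (auto simp: abs_mult intro!: mult_left_mono)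
    also have "\<dots> = c * (\<Sum>j\<in>K \<inter> N k. p k * p j)"
      by (simp add: expectation_of_bool p_def sum_distrib_left[symmetric])
    finally have 1: "\<bar>?E (\<lambda>x. p k * (g (W x + 1) - g (V k x + 1)))\<bar> \<le> \<dots>" .
    have "\<bar>?E (\<lambda>x. of_bool (I k x) * (g (W x) - g (V k x + 1)))\<bar>
        \<le> ?E (\<lambda>x. \<bar>of_bool (I k x) * (g (W x) - g (V k x + 1))\<bar>)"
      by (rule integral_abs_bound)
    also have "\<dots> \<le> ?E (\<lambda>x. c * (\<Sum>j\<in>K \<inter> N k - {k}. of_bool (I k x \<and> I j x)))"
      using b2[OF k] by (intro integral_mono) auto
    also have "\<dots> = c * (\<Sum>j\<in>K \<inter> N k - {k}. measure_pmf.prob M {x. I k x \<and> I j x})"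
      by (simp add: expectation_of_bool del: of_bool_conj)
    finally have 2: "\<bar>?E (\<lambda>x. of_bool (I k x) * (g (W x) - g (V k x + 1)))\<bar> \<le> \<dots>" .
    show "\<bar>?E (\<lambda>x. p k * (g (W x + 1) - g (V k x + 1))) -
        ?E (\<lambda>x. of_bool (I k x) * (g (W x) - g (V k x + 1)))\<bar>
      \<le> c * ((\<Sum>j\<in>K \<inter> N k. p k * p j) + (\<Sum>j\<in>K \<inter> N k - {k}. measure_pmf.prob M {x. I k x \<and> I j x}))"
      using 1 2 by (simp add: distrib_left)
  qed
  finally show ?thesis by (simp add: sum_distrib_left)
qed

section \<open>Functions of independent coordinates\<close>

lemma expectation_pair_pmf_finite:
  fixes f :: "'a \<times> 'b \<Rightarrow> real"
  assumes p: "finite (set_pmf p)" and q: "finite (set_pmf q)"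
  shows "measure_pmf.expectation (pair_pmf p q) f =
    measure_pmf.expectation p (\<lambda>x. measure_pmf.expectation q (\<lambda>y. f (x, y)))"
proof -
  have "measure_pmf.expectation (pair_pmf p q) f =
      (\<Sum>z\<in>set_pmf p \<times> set_pmf q. f z * pmf (pair_pmf p q) z)"
    using p q by (intro integral_measure_pmf_real) auto
  also have "\<dots> = (\<Sum>x\<in>set_pmf p. \<Sum>y\<in>set_pmf q. f (x, y) * pmf (pair_pmf p q) (x, y))"
    by (simp add: sum.cartesian_product)
  also have "\<dots> = (\<Sum>x\<in>set_pmf p. (\<Sum>y\<in>set_pmf q. f (x, y) * pmf q y) * pmf p x)"
    by (simp add: pmf_pair sum_distrib_left sum_distrib_right mult_ac)
  also have "\<dots> = measure_pmf.expectation p (\<lambda>x. \<Sum>y\<in>set_pmf q. f (x, y) * pmf q y)"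
    using p by (intro integral_measure_pmf_real[symmetric]) auto
  also have "\<dots> = measure_pmf.expectation p (\<lambda>x. measure_pmf.expectation q (\<lambda>y. f (x, y)))"
    using q by (intro Bochner_Integration.integral_cong refl integral_measure_pmf_real[symmetric]) auto
  finally show ?thesis .
qed

lemma expectation_cong:
  assumes "\<And>x. x \<in> set_pmf M \<Longrightarrow> f x = (g x :: real)"
  shows "measure_pmf.expectation M f = measure_pmf.expectation M g"
  by (rule integral_cong_AE) (auto simp: AE_measure_pmf_iff assms)

lemma finite_set_Pi_pmf:
  assumes "finite D" "\<And>x. x \<in> D \<Longrightarrow> finite (set_pmf (p x))"
  shows "finite (set_pmf (Pi_pmf D dflt p))"
  using assms by (subst set_Pi_pmf) auto

definition depends_on :: "'a set \<Rightarrow> (('a \<Rightarrow> 'b) \<Rightarrow> 'c) \<Rightarrow> bool" where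
  "depends_on A F \<longleftrightarrow> (\<forall>c c'. (\<forall>t\<in>A. c t = c' t) \<longrightarrow> F c = F c')"

lemma depends_onD: "depends_on A F \<Longrightarrow> (\<And>t. t \<in> A \<Longrightarrow> c t = c' t) \<Longrightarrow> F c = F c'"
  unfolding depends_on_def by blast

lemma depends_on_mono: "depends_on A F \<Longrightarrow> A \<subseteq> B \<Longrightarrow> depends_on B F"
  unfolding depends_on_def by blast

lemma Pi_pmf_expectation_mult:
  fixes X Y :: "('a \<Rightarrow> 'b) \<Rightarrow> real"
  assumes D: "finite D" "\<And>x. x \<in> D \<Longrightarrow> finite (set_pmf (p x))"
    and X: "depends_on A X" and Y: "depends_on (- A) Y"
  shows "measure_pmf.expectation (Pi_pmf D dflt p) (\<lambda>c. X c * Y c) =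
    measure_pmf.expectation (Pi_pmf D dflt p) X * measure_pmf.expectation (Pi_pmf D dflt p) Y"
proof -
  let ?P = "Pi_pmf (D \<inter> A) dflt p" and ?Q = "Pi_pmf (D - A) dflt p"
  have fP: "finite (set_pmf ?P)" and fQ: "finite (set_pmf ?Q)"
    using D by (auto intro!: finite_set_Pi_pmf)
  have split: "Pi_pmf D dflt p =
      map_pmf (\<lambda>(f, g) x. if x \<in> D \<inter> A then f x else g x) (pair_pmf ?P ?Q)"
  proof -
    have "D = (D \<inter> A) \<union> (D - A)" by auto
    then show ?thesis using Pi_pmf_union[of "D \<inter> A" "D - A" dflt p] D by auto
  qed
  have main: "measure_pmf.expectation (Pi_pmf D dflt p) (\<lambda>c. X c * Y c) =
      measure_pmf.expectation ?P X * measure_pmf.expectation ?Q Y"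
    if X: "depends_on A X" and Y: "depends_on (- A) Y" for X Y :: "('a \<Rightarrow> 'b) \<Rightarrow> real"
  proof -
    have Yg: "Y (\<lambda>x. if x \<in> D \<inter> A then f x else g x) = Y g" for f g
      by (rule depends_onD[OF Y]) auto
    have Xf: "X (\<lambda>x. if x \<in> D \<inter> A then f x else g x) = X f"
      if "f \<in> set_pmf ?P" "g \<in> set_pmf ?Q" for f g
    proof (rule depends_onD[OF X])
      have "\<forall>x. x \<notin> D \<inter> A \<longrightarrow> f x = dflt" "\<forall>x. x \<notin> D - A \<longrightarrow> g x = dflt"
        using that set_Pi_pmf_subset[of "D \<inter> A" dflt p] set_Pi_pmf_subset[of "D - A" dflt p] D by auto
      then show "(if t \<in> D \<inter> A then f t else g t) = f t" if "t \<in> A" for t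
        using that by auto
    qed
    have "measure_pmf.expectation (Pi_pmf D dflt p) (\<lambda>c. X c * Y c) =
        measure_pmf.expectation ?P (\<lambda>f. measure_pmf.expectation ?Q (\<lambda>g.
          X (\<lambda>x. if x \<in> D \<inter> A then f x else g x) * Y (\<lambda>x. if x \<in> D \<inter> A then f x else g x)))"
      unfolding split by (simp add: expectation_pair_pmf_finite[OF fP fQ])
    also have "\<dots> = measure_pmf.expectation ?P (\<lambda>f. measure_pmf.expectation ?Q (\<lambda>g. X f * Y g))"
      by (rule expectation_cong, rule expectation_cong) (simp only: Xf Yg)
    finally show ?thesis by simp
  qed
  have one: "depends_on B (\<lambda>_. 1 :: real)" for B :: "'a set"
    by (simp add: depends_on_def)
  show ?thesis
    using main[OF X Y] main[OF X one] main[OF one Y] by simp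
qed

section \<open>Inversion codes of a Mallows permutation\<close>

definition tgeom :: "real \<Rightarrow> nat \<Rightarrow> nat pmf" where
  "tgeom q t = embed_pmf (\<lambda>j. if j < t then q ^ j / (\<Sum>i<t. q ^ i) else 0)"

definition codes :: "real \<Rightarrow> nat \<Rightarrow> (nat \<Rightarrow> nat) pmf" where
  "codes q n = Pi_pmf {1..n} 0 (tgeom q)"

lemma pmf_tgeom:
  assumes q: "q > 0" and t: "t \<ge> 1"
  shows "pmf (tgeom q t) j = (if j < t then q ^ j / (\<Sum>i<t. q ^ i) else 0)"
proof -
  let ?Z = "\<Sum>i<t. q ^ i"
  let ?f = "\<lambda>j. if j < t then q ^ j / ?Z else 0"
  have Z: "?Z > 0" using q t by (intro sum_pos) (auto simp: lessThan_empty_iff)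
  have nonneg: "?f j \<ge> 0" for j using q Z by simp
  have "(\<integral>\<^sup>+j. ennreal (?f j) \<partial>count_space UNIV) = (\<Sum>j<t. ennreal (?f j))"
    by (rule nn_integral_count_space') auto
  also have "\<dots> = ennreal (\<Sum>j<t. ?f j)" by (rule sum_ennreal) (rule nonneg)
  also have "(\<Sum>j<t. ?f j) = 1" using Z by (simp flip: sum_divide_distrib)
  finally show ?thesis unfolding tgeom_def using nonneg by (subst pmf_embed_pmf) auto
qed

locale mallows_param =
  fixes q :: real
  assumes q0: "0 < q" and q1: "q < 1"
begin

lemma geom_sum: "(\<Sum>i<t. q ^ i) = (1 - q ^ t) / (1 - q)"
  using q1 by (simp add: sum_gp_strict)

lemma one_minus_pow_pos: "t \<ge> 1 \<Longrightarrow> 0 < 1 - q ^ t"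
  using q0 q1 by (simp add: power_less_one_iff)

lemma pmf_tgeom': "t \<ge> 1 \<Longrightarrow> pmf (tgeom q t) j = (if j < t then (1 - q) * q ^ j / (1 - q ^ t) else 0)"
  using pmf_tgeom[OF q0, of t j] q1 by (simp add: geom_sum)

lemma set_tgeom: "t \<ge> 1 \<Longrightarrow> set_pmf (tgeom q t) = {..<t}"
  using q0 q1 one_minus_pow_pos[of t] by (auto simp: set_pmf_eq pmf_tgeom')

lemma set_codes: "set_pmf (codes q n) = PiE_dflt {1..n} 0 lessThan"
  unfolding codes_def by (subst set_Pi_pmf) (auto simp: PiE_dflt_def set_tgeom)

lemma finite_codes: "finite (set_pmf (codes q n))"
  unfolding codes_def by (rule finite_set_Pi_pmf) (auto simp: set_tgeom)

lemma integrable_codes [simp]: "integrable (measure_pmf (codes q n)) (f :: _ \<Rightarrow> real)"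
  by (rule integrable_measure_pmf_finite[OF finite_codes])

lemma integrable_tgeom [simp]: "t \<ge> 1 \<Longrightarrow> integrable (measure_pmf (tgeom q t)) (f :: _ \<Rightarrow> real)"
  by (rule integrable_measure_pmf_finite) (simp add: set_tgeom)

lemma pmf_tgeom_ge: "j < t \<Longrightarrow> pmf (tgeom q t) j \<ge> (1 - q) * q ^ j"
  using q0 q1 one_minus_pow_pos[of t] by (auto simp: pmf_tgeom' field_simps)

lemma pmf_tgeom_le: "t \<ge> 1 \<Longrightarrow> pmf (tgeom q t) j \<le> (1 - q) / (1 - q ^ t)"
  using q0 q1 one_minus_pow_pos[of t] power_le_one[of q j] by (auto simp: pmf_tgeom' divide_simps mult_left_le)

lemma prob_tgeom_lessThan:
  assumes "1 \<le> t" "a \<le> t"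
  shows "measure_pmf.prob (tgeom q t) {..<a} = (1 - q ^ a) / (1 - q ^ t)"
proof -
  have "measure_pmf.prob (tgeom q t) {..<a} = (\<Sum>j<a. (1 - q) * q ^ j / (1 - q ^ t))"
    using assms by (simp add: measure_measure_pmf_finite pmf_tgeom')
  also have "\<dots> = (1 - q) * (\<Sum>j<a. q ^ j) / (1 - q ^ t)"
    by (simp add: sum_divide_distrib sum_distrib_left)
  finally show ?thesis using q1 by (simp add: geom_sum)
qed

text \<open>Truncation only moves mass downwards, so the bounds for the untruncated geometric law persist for
every \<open>a\<close>, even beyond the truncation point.\<close>

lemma prob_tgeom_atMost_ge:
  assumes "1 \<le> t"
  shows "measure_pmf.prob (tgeom q t) {..a} \<ge> 1 - q ^ (a + 1)"
proof (cases "a + 1 \<le> t")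
  case True
  have "1 - q ^ (a + 1) \<le> (1 - q ^ (a + 1)) / (1 - q ^ t)"
    using one_minus_pow_pos[of t] one_minus_pow_pos[of "a + 1"] assms q0
    by (simp add: divide_simps mult_left_le)
  then show ?thesis using prob_tgeom_lessThan[OF assms True] by (simp add: lessThan_Suc_atMost)
next
  case False
  have "measure_pmf.prob (tgeom q t) {..a} = 1"
    using False assms by (subst measure_pmf.prob_eq_1) (auto simp: AE_measure_pmf_iff set_tgeom)
  then show ?thesis using q0 by simp
qed

lemma prob_tgeom_greater_le:
  assumes "1 \<le> t"
  shows "measure_pmf.prob (tgeom q t) {a<..} \<le> q ^ (a + 1)"
proof -
  have "measure_pmf.prob (tgeom q t) (UNIV - {..a}) = 1 - measure_pmf.prob (tgeom q t) {..a}"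
    using measure_pmf.prob_compl[of "{..a}" "tgeom q t"] by simp
  moreover have "UNIV - {..a} = {a<..}" by auto
  ultimately show ?thesis using prob_tgeom_atMost_ge[OF assms, of a] by simp
qed

lemma expectation_codes_Suc:
  fixes F :: "(nat \<Rightarrow> nat) \<Rightarrow> real"
  shows "measure_pmf.expectation (codes q (Suc n)) F =
    measure_pmf.expectation (codes q n) (\<lambda>c. measure_pmf.expectation (tgeom q (Suc n)) (\<lambda>x. F (c(Suc n := x))))"
proof -
  have "codes q (Suc n) = map_pmf (\<lambda>(y, f). f(Suc n := y)) (pair_pmf (tgeom q (Suc n)) (codes q n))"
    unfolding codes_def using Pi_pmf_insert[of "{1..n}" "Suc n" 0 "tgeom q"]
    by (simp add: atLeastAtMostSuc_conv)
  also have "\<dots> = map_pmf (\<lambda>(f, y). f(Suc n := y)) (pair_pmf (codes q n) (tgeom q (Suc n)))"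
    by (subst pair_commute_pmf) (simp add: pmf.map_comp o_def case_prod_unfold)
  finally show ?thesis
    by (simp add: case_prod_beta expectation_pair_pmf_finite finite_codes set_tgeom)
qed

lemma expectation_codes_marginal:
  fixes F :: "(nat \<Rightarrow> nat) \<Rightarrow> real"
  assumes "depends_on {1..s} F" "s \<le> n"
  shows "measure_pmf.expectation (codes q n) F = measure_pmf.expectation (codes q s) F"
proof -
  have "codes q s = map_pmf (\<lambda>f x. if x \<in> {1..s} then f x else 0) (codes q n)"
    unfolding codes_def using assms(2) by (intro Pi_pmf_subset) auto
  then have "measure_pmf.expectation (codes q s) F =
      measure_pmf.expectation (codes q n) (\<lambda>f. F (\<lambda>x. if x \<in> {1..s} then f x else 0))" by simp
  also have "\<dots> = measure_pmf.expectation (codes q n) F"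
    by (intro Bochner_Integration.integral_cong refl depends_onD[OF assms(1)]) simp
  finally show ?thesis ..
qed

lemma expectation_codes_mult:
  assumes "depends_on A X" "depends_on (- A) Y"
  shows "measure_pmf.expectation (codes q n) (\<lambda>c. X c * Y c) =
    measure_pmf.expectation (codes q n) X * measure_pmf.expectation (codes q n) (Y :: _ \<Rightarrow> real)"
  unfolding codes_def by (rule Pi_pmf_expectation_mult) (use assms in \<open>auto simp: set_tgeom\<close>)

end

text \<open>The number of entries among the first \<open>t\<close> that exceed the \<open>j\<close>-th one, computed from the codes. For
\<open>t < j\<close> the value is set to \<open>c j\<close>, which keeps the recursion total.\<close>

primrec rank_at :: "(nat \<Rightarrow> nat) \<Rightarrow> nat \<Rightarrow> nat \<Rightarrow> nat" where
  "rank_at c j 0 = c j"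
| "rank_at c j (Suc t) = (if t < j then c j else rank_at c j t + of_bool (c (Suc t) \<le> rank_at c j t))"

lemma rank_at_init: "t \<le> j \<Longrightarrow> rank_at c j t = c j"
  by (cases t) auto

lemma rank_at_Suc: "j \<le> t \<Longrightarrow> rank_at c j (Suc t) = rank_at c j t + of_bool (c (Suc t) \<le> rank_at c j t)"
  by simp

lemma rank_at_depends: "depends_on {j..max j t} (\<lambda>c. rank_at c j t)"
proof -
  have "rank_at c j t = rank_at c' j t" if "\<And>i. j \<le> i \<Longrightarrow> i \<le> max j t \<Longrightarrow> c i = c' i" for c c' :: "nat \<Rightarrow> nat"
    using that
  proof (induction t)
    case (Suc t)
    have "c i = c' i" if "j \<le> i" "i \<le> max j t" for i
      by (rule Suc.prems) (use that in linarith)+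
    then have "rank_at c j t = rank_at c' j t" by (rule Suc.IH)
    moreover have "c j = c' j" by (rule Suc.prems) auto
    moreover have "\<not> t < j \<Longrightarrow> c (Suc t) = c' (Suc t)" by (rule Suc.prems) auto
    ultimately show ?case by simp
  qed simp
  then show ?thesis unfolding depends_on_def by (metis atLeastAtMost_iff)
qed

text \<open>The sets of earlier entries exceeding a given value form a chain, so comparing their sizes compares
the values. This is why the code of a new entry determines its position relative to all old ones.\<close>

lemma card_exceeding_le_iff:
  fixes \<pi> :: "nat \<Rightarrow> nat"
  assumes "inj_on \<pi> {1..Suc t}" "1 \<le> j" "j \<le> t"
  shows "card {i \<in> {1..t}. \<pi> i > \<pi> (Suc t)} \<le> card {i \<in> {1..t}. \<pi> i > \<pi> j} \<longleftrightarrow> \<pi> (Suc t) > \<pi> j"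
proof
  assume "\<pi> (Suc t) > \<pi> j"
  then show "card {i \<in> {1..t}. \<pi> i > \<pi> (Suc t)} \<le> card {i \<in> {1..t}. \<pi> i > \<pi> j}"
    by (intro card_mono) auto
next
  assume le: "card {i \<in> {1..t}. \<pi> i > \<pi> (Suc t)} \<le> card {i \<in> {1..t}. \<pi> i > \<pi> j}"
  show "\<pi> (Suc t) > \<pi> j"
  proof (rule ccontr)
    assume "\<not> \<pi> (Suc t) > \<pi> j"
    moreover have "\<pi> (Suc t) \<noteq> \<pi> j"
      using inj_onD[OF assms(1), of "Suc t" j] assms(2,3) by auto
    ultimately have less: "\<pi> (Suc t) < \<pi> j" by simp
    have "{i \<in> {1..t}. \<pi> i > \<pi> j} \<subseteq> {i \<in> {1..t}. \<pi> i > \<pi> (Suc t)}"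
      using less by (auto intro: less_trans)
    moreover have "j \<in> {i \<in> {1..t}. \<pi> i > \<pi> (Suc t)}" "j \<notin> {i \<in> {1..t}. \<pi> i > \<pi> j}"
      using less assms(2,3) by auto
    ultimately have "{i \<in> {1..t}. \<pi> i > \<pi> j} \<subset> {i \<in> {1..t}. \<pi> i > \<pi> (Suc t)}"
      by blast
    then have "card {i \<in> {1..t}. \<pi> i > \<pi> j} < card {i \<in> {1..t}. \<pi> i > \<pi> (Suc t)}"
      by (rule psubset_card_mono[rotated]) simp
    then show False using le by simp
  qed
qed

definition code :: "nat \<Rightarrow> (nat \<Rightarrow> nat) \<Rightarrow> nat \<Rightarrow> nat" where
  "code n \<pi> t = (if t \<in> {1..n} then card {i \<in> {1..<t}. \<pi> i > \<pi> t} else 0)"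

lemma rank_at_code:
  assumes "inj_on \<pi> {1..n}" "1 \<le> j" "j \<le> t" "t \<le> n"
  shows "rank_at (code n \<pi>) j t = card {i \<in> {1..t}. \<pi> i > \<pi> j}"
  using assms(3,4)
proof (induction t rule: dec_induct)
  case base
  have "{i \<in> {1..<j}. \<pi> i > \<pi> j} = {i \<in> {1..j}. \<pi> i > \<pi> j}"
    by (auto intro: le_neq_implies_less)
  then show ?case using assms(2) base by (simp add: rank_at_init code_def)
next
  case (step t)
  have inj: "inj_on \<pi> {1..Suc t}" using step.prems by (intro inj_on_subset[OF assms(1)]) auto
  have "code n \<pi> (Suc t) = card {i \<in> {1..t}. \<pi> i > \<pi> (Suc t)}"
    using step(4) by (simp add: code_def atLeastLessThanSuc_atLeastAtMost)
  moreover have "rank_at (code n \<pi>) j t = card {i \<in> {1..t}. \<pi> i > \<pi> j}"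
    using step.IH step.prems by simp
  moreover have "card {i \<in> {1..Suc t}. \<pi> i > \<pi> j} = card {i \<in> {1..t}. \<pi> i > \<pi> j} + of_bool (\<pi> (Suc t) > \<pi> j)"
  proof (cases "\<pi> (Suc t) > \<pi> j")
    case True
    then have "{i \<in> {1..Suc t}. \<pi> i > \<pi> j} = insert (Suc t) {i \<in> {1..t}. \<pi> i > \<pi> j}" by auto
    then show ?thesis using True by simp
  next
    case False
    then have "{i \<in> {1..Suc t}. \<pi> i > \<pi> j} = {i \<in> {1..t}. \<pi> i > \<pi> j}"
      using le_Suc_eq by auto
    then show ?thesis using False by simp
  qed
  ultimately show ?case
    using card_exceeding_le_iff[OF inj assms(2) step(1)] step(1) by simp
qed

lemma perm_eq_rank_at_code:
  assumes "\<pi> \<in> perms n" "j \<in> {1..n}"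
  shows "rank_at (code n \<pi>) j n = n - \<pi> j" and "\<pi> j \<in> {1..n}"
proof -
  have p: "\<pi> permutes {1..n}" using assms by (simp add: perms_def)
  have inj: "inj_on \<pi> {1..n}" by (rule permutes_inj_on[OF p])
  show r: "\<pi> j \<in> {1..n}" using permutes_in_image[OF p] assms(2) by blast
  have "\<pi> ` {i \<in> {1..n}. \<pi> i > \<pi> j} = {\<pi> j<..n}"
  proof -
    have "\<pi> ` {i \<in> {1..n}. \<pi> i > \<pi> j} = {v \<in> \<pi> ` {1..n}. v > \<pi> j}" by auto
    also have "\<pi> ` {1..n} = {1..n}" by (rule permutes_image[OF p])
    finally show ?thesis by auto
  qed
  then have "card {i \<in> {1..n}. \<pi> i > \<pi> j} = n - \<pi> j"
    using card_image[OF inj_on_subset[OF inj, of "{i \<in> {1..n}. \<pi> i > \<pi> j}"]] by (simp add: subset_iff)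
  then show "rank_at (code n \<pi>) j n = n - \<pi> j"
    using rank_at_code[OF inj, of j n] assms(2) by simp
qed

lemma inv_count_eq_sum_code: "inv_count n \<pi> = (\<Sum>t\<in>{1..n}. code n \<pi> t)"
proof -
  have "bij_betw (\<lambda>(t, i). (i, t)) (SIGMA t:{1..n}. {i \<in> {1..<t}. \<pi> i > \<pi> t})
      {(i, j). 1 \<le> i \<and> i < j \<and> j \<le> n \<and> \<pi> i > \<pi> j}"
    by (rule bij_betwI[where g = "\<lambda>(i, j). (j, i)"]) auto
  then have "inv_count n \<pi> = card (SIGMA t:{1..n}. {i \<in> {1..<t}. \<pi> i > \<pi> t})"
    unfolding inv_count_def by (simp add: bij_betw_same_card)
  also have "\<dots> = (\<Sum>t\<in>{1..n}. card {i \<in> {1..<t}. \<pi> i > \<pi> t})"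
    by (rule card_SigmaI) auto
  finally show ?thesis by (simp add: code_def)
qed

text \<open>The ranks at time \<open>n\<close> recover the permutation from its code; both sides have \<open>n!\<close> elements.\<close>

lemma bij_betw_code: "bij_betw (code n) (perms n) (PiE_dflt {1..n} 0 lessThan)"
proof -
  have inj: "inj_on (code n) (perms n)"
  proof (rule inj_onI, rule ext)
    fix \<pi> \<pi>' j assume h: "\<pi> \<in> perms n" "\<pi>' \<in> perms n" "code n \<pi> = code n \<pi>'"
    show "\<pi> j = \<pi>' j"
    proof (cases "j \<in> {1..n}")
      case True
      then have "n - \<pi> j = n - \<pi>' j" "\<pi> j \<le> n" "\<pi>' j \<le> n"
        using perm_eq_rank_at_code[OF h(1) True] perm_eq_rank_at_code[OF h(2) True] h(3) by auto
      then show ?thesis by simp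
    next
      case False
      then show ?thesis using h by (auto simp: perms_def permutes_def)
    qed
  qed
  have fin: "finite (PiE_dflt {1..n} (0::nat) lessThan)" by (rule finite_PiE_dflt) auto
  have sub: "code n ` perms n \<subseteq> PiE_dflt {1..n} 0 lessThan"
  proof -
    have "card {i \<in> {1..<t}. \<pi> i > \<pi> t} < t" if "t \<ge> 1" for t and \<pi> :: "nat \<Rightarrow> nat"
    proof -
      have "card {i \<in> {1..<t}. \<pi> i > \<pi> t} \<le> card {1..<t}" by (intro card_mono) auto
      then show ?thesis using that by simp
    qed
    then show ?thesis by (auto simp: PiE_dflt_def code_def)
  qed
  have "card (code n ` perms n) = card (PiE_dflt {1..n} (0::nat) lessThan)"
    using inj by (subst card_image) (auto simp: perms_def card_permutations card_PiE_dflt fact_prod)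
  with fin sub have "code n ` perms n = PiE_dflt {1..n} 0 lessThan"
    by (intro card_subset_eq)
  with inj show ?thesis by (simp add: bij_betw_def)
qed

text \<open>The weight \<open>q ^ inv\<close> factorises over the code because the code sums to the number of inversions.
That the normalising constants agree follows from summing over all codes.\<close>

lemma (in mallows_param) map_code_mallows: "map_pmf (code n) (mallows n q) = codes q n"
proof (rule pmf_eqI)
  fix c
  let ?C = "PiE_dflt {1..n} (0::nat) lessThan"
  let ?Z = "\<Sum>\<pi>\<in>perms n. q ^ inv_count n \<pi>"
  define G where "G = (\<Prod>t\<in>{1..n}. \<Sum>i<t. q ^ i)"
  have finC: "finite ?C" by (rule finite_PiE_dflt) auto
  have pc: "pmf (codes q n) c = q ^ (\<Sum>t\<in>{1..n}. c t) / G" if "c \<in> ?C" for c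
  proof -
    have "pmf (codes q n) c = (\<Prod>t\<in>{1..n}. pmf (tgeom q t) (c t))"
      unfolding codes_def using that by (intro pmf_Pi') (auto simp: PiE_dflt_def)
    also have "\<dots> = (\<Prod>t\<in>{1..n}. q ^ c t / (\<Sum>i<t. q ^ i))"
      using that by (intro prod.cong refl) (auto simp: PiE_dflt_def pmf_tgeom[OF q0])
    finally show ?thesis by (simp add: prod_dividef power_sum G_def)
  qed
  have G: "G > 0" unfolding G_def using q0 by (intro prod_pos) (auto intro!: sum_pos simp: lessThan_empty_iff)
  have "?Z = (\<Sum>\<pi>\<in>perms n. q ^ (\<Sum>t\<in>{1..n}. code n \<pi> t))" by (simp add: inv_count_eq_sum_code)
  also have "\<dots> = (\<Sum>c\<in>?C. q ^ (\<Sum>t\<in>{1..n}. c t))"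
    by (rule sum.reindex_bij_betw[OF bij_betw_code])
  also have "\<dots> = (\<Sum>c\<in>?C. G * pmf (codes q n) c)"
    using G by (intro sum.cong refl) (simp add: pc)
  also have "\<dots> = G" using sum_pmf_eq_1[OF finC, of "codes q n"]
    by (simp add: set_codes flip: sum_distrib_left)
  finally have ZG: "?Z = G" .
  have supp: "set_pmf (mallows n q) = perms n"
  proof -
    have "?Z > 0" using ZG G by simp
    then have "?Z \<noteq> 0" by (rule less_imp_neq[symmetric])
    then show ?thesis using q0 unfolding set_pmf_eq pmf_mallows[OF q0] by auto
  qed
  show "pmf (map_pmf (code n) (mallows n q)) c = pmf (codes q n) c"
  proof (cases "c \<in> ?C")
    case True
    then obtain \<pi> where \<pi>: "\<pi> \<in> perms n" "c = code n \<pi>"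
      using bij_betw_code[of n] by (auto simp: bij_betw_def)
    have "pmf (map_pmf (code n) (mallows n q)) c = pmf (mallows n q) \<pi>"
      unfolding \<pi>(2) using bij_betw_code[of n] \<pi>(1)
      by (intro pmf_map_inj) (auto simp: supp bij_betw_def)
    also have "\<dots> = pmf (codes q n) c"
      unfolding pmf_mallows[OF q0] \<pi>(2) pc[OF True[unfolded \<pi>(2)]] ZG
      by (simp only: \<pi>(1) inv_count_eq_sum_code if_True)
    finally show ?thesis .
  next
    case False
    then have "c \<notin> code n ` perms n" using bij_betw_code[of n] by (auto simp: bij_betw_def)
    then have "pmf (map_pmf (code n) (mallows n q)) c = 0"
      by (simp add: pmf_map_outside supp)
    moreover have "pmf (codes q n) c = 0" using False set_codes[of n] by (metis pmf_eq_0_set_pmf)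
    ultimately show ?thesis by simp
  qed
qed

section \<open>The growth of ranks\<close>

lemma rank_at_fun_upd: "j \<le> s \<Longrightarrow> rank_at (c(Suc s := x)) j s = rank_at c j s"
  by (rule depends_onD[OF rank_at_depends]) auto

lemma rank_at_Suc_fun_upd:
  "j \<le> s \<Longrightarrow> rank_at (c(Suc s := x)) j (Suc s) = rank_at c j s + of_bool (x \<le> rank_at c j s)"
  by (simp add: rank_at_fun_upd)

lemma depends_on_compose: "depends_on A F \<Longrightarrow> depends_on A (\<lambda>c. h (F c))"
  unfolding depends_on_def by metis

context mallows_param
begin

definition potential :: "nat \<Rightarrow> real" where
  "potential a = q ^ (a + 1) / (1 - q ^ (a + 1))"

lemma potential_decreasing: "potential (Suc a) \<le> potential a"
proof -
  have "q ^ (Suc a + 1) \<le> q ^ (a + 1)" using q0 q1 by (intro power_decreasing) auto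
  then show ?thesis unfolding potential_def
    using one_minus_pow_pos[of "a + 1"] one_minus_pow_pos[of "Suc a + 1"] q0
    by (intro frac_le) auto
qed

lemma potential_ge: "q ^ (a + 1) \<le> potential a"
  unfolding potential_def using one_minus_pow_pos[of "a + 1"] q0
  by (simp add: divide_simps mult_left_le)

text \<open>With \<open>x = q ^ (a + 1)\<close> the odds \<open>x / (1 - x)\<close> are the right potential: in the continuous
approximation a rank grows at rate \<open>1 - x\<close>, so that \<open>1 / x - 1\<close> grows exponentially at rate \<open>1 - q\<close>.
The factor is close to \<open>q\<close> for large \<open>a\<close> and is worst at \<open>a = 0\<close>, where half of the rate is lost.\<close>

lemma potential_contraction:
  "(1 - q ^ (a + 1)) * potential (Suc a) + q ^ (a + 1) * potential a \<le> (1 - (1 - q) / 2) * potential a"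
proof -
  define u where "u = q ^ (a + 1)"
  have u: "0 < u" "u \<le> q" "u < 1"
    using q0 q1 one_minus_pow_pos[of "a + 1"] power_decreasing[of 1 "a + 1" q]
    by (auto simp: u_def)
  have "q * u \<le> 1 * u" using u q1 by (intro mult_right_mono) auto
  then have qu: "q * u < 1" using u by linarith
  have pa: "potential a = u / (1 - u)" and pSa: "potential (Suc a) = q * u / (1 - q * u)"
    by (auto simp: potential_def u_def)
  have "u * (2 - q) \<le> q * (2 - q)" using u q1 by (intro mult_right_mono) auto
  also have "\<dots> \<le> 1" using zero_le_power2[of "1 - q"] by (simp add: power2_eq_square algebra_simps)
  finally have key: "2 * (1 - u) \<ge> 1 - q * u" by (simp add: algebra_simps)
  have "(1 - (1 - q) / 2 - u) * u * (1 - q * u) - (1 - u) * (q * u) * (1 - u)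
      = (1 - q) * u * (2 * (1 - u) - (1 - q * u)) / 2"
    by (simp add: field_simps)
  also have "\<dots> \<ge> 0" using key u q1 by simp
  finally have "(1 - u) * (q * u) * (1 - u) \<le> (1 - (1 - q) / 2 - u) * u * (1 - q * u)" by simp
  then have "(1 - u) * (q * u) / (1 - q * u) \<le> (1 - (1 - q) / 2 - u) * u / (1 - u)"
    using u qu by (simp add: pos_divide_le_eq pos_le_divide_eq)
  then show ?thesis unfolding pa pSa u_def[symmetric] by (simp add: left_diff_distrib diff_divide_distrib)
qed

lemma expectation_tgeom_of_bool:
  "1 \<le> t \<Longrightarrow> measure_pmf.expectation (tgeom q t) (\<lambda>x. of_bool (Q x) * u + of_bool (R x) * v)
    = measure_pmf.prob (tgeom q t) {x. Q x} * u + measure_pmf.prob (tgeom q t) {x. R x} * v"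
  by (simp add: expectation_of_bool)

lemma expectation_potential_step:
  assumes "1 \<le> t"
  shows "measure_pmf.expectation (tgeom q t) (\<lambda>x. potential (a + of_bool (x \<le> a))) \<le> (1 - (1 - q) / 2) * potential a"
proof -
  define P where "P = measure_pmf.prob (tgeom q t) {..a}"
  have P: "P \<ge> 1 - q ^ (a + 1)" unfolding P_def by (rule prob_tgeom_atMost_ge[OF assms])
  have "measure_pmf.expectation (tgeom q t) (\<lambda>x. potential (a + of_bool (x \<le> a))) =
      measure_pmf.expectation (tgeom q t) (\<lambda>x. of_bool (x \<le> a) * potential (Suc a) + of_bool (\<not> x \<le> a) * potential a)"
    by (rule Bochner_Integration.integral_cong) auto
  also have "\<dots> = P * potential (Suc a) + (1 - P) * potential a"
  proof -
    have "{x. \<not> x \<le> a} = UNIV - {..a}" "{x. x \<le> a} = {..a}" by auto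
    then show ?thesis
      using measure_pmf.prob_compl[of "{..a}" "tgeom q t"]
      unfolding expectation_tgeom_of_bool[OF assms] by (simp add: P_def)
  qed
  also have "\<dots> = potential a - P * (potential a - potential (Suc a))" by (simp add: algebra_simps)
  also have "\<dots> \<le> potential a - (1 - q ^ (a + 1)) * (potential a - potential (Suc a))"
    using P potential_decreasing[of a] by (intro diff_mono mult_right_mono) auto
  also have "\<dots> = (1 - q ^ (a + 1)) * potential (Suc a) + q ^ (a + 1) * potential a" by (simp add: algebra_simps)
  also have "\<dots> \<le> (1 - (1 - q) / 2) * potential a" by (rule potential_contraction)
  finally show ?thesis .
qed

lemma expectation_potential_rank_at:
  assumes "1 \<le> j" "j \<le> s"
  shows "measure_pmf.expectation (codes q s) (\<lambda>c. potential (rank_at c j s)) \<le> 1 / (1 - q) * (1 - (1 - q) / 2) ^ (s - j)"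
  using assms(2)
proof (induction s rule: dec_induct)
  case base
  have "potential a \<le> 1 / (1 - q)" for a
  proof -
    have "potential a \<le> potential 0" by (induction a) (auto intro: order.trans[OF potential_decreasing])
    also have "\<dots> \<le> 1 / (1 - q)" using q0 q1 by (simp add: potential_def divide_right_mono)
    finally show ?thesis .
  qed
  then have "measure_pmf.expectation (codes q j) (\<lambda>c. potential (rank_at c j j)) \<le> measure_pmf.expectation (codes q j) (\<lambda>_. 1 / (1 - q))"
    by (intro integral_mono) auto
  then show ?case by simp
next
  case (step s)
  have "measure_pmf.expectation (codes q (Suc s)) (\<lambda>c. potential (rank_at c j (Suc s))) =
      measure_pmf.expectation (codes q s) (\<lambda>c. measure_pmf.expectation (tgeom q (Suc s))
        (\<lambda>x. potential (rank_at c j s + of_bool (x \<le> rank_at c j s))))"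
    unfolding expectation_codes_Suc using step(1) by (simp only: rank_at_Suc_fun_upd)
  also have "\<dots> \<le> measure_pmf.expectation (codes q s) (\<lambda>c. (1 - (1 - q) / 2) * potential (rank_at c j s))"
    by (intro integral_mono expectation_potential_step) auto
  also have "\<dots> = (1 - (1 - q) / 2) * measure_pmf.expectation (codes q s) (\<lambda>c. potential (rank_at c j s))"
    by simp
  also have "\<dots> \<le> (1 - (1 - q) / 2) * (1 / (1 - q) * (1 - (1 - q) / 2) ^ (s - j))"
    using step.IH q0 q1 by (intro mult_left_mono) auto
  finally show ?case using step(1) by (simp add: Suc_diff_le mult_ac)
qed

text \<open>Given the rank \<open>a\<close>, the next code exceeds it with probability at most \<open>q ^ (a + 1)\<close>, which is
dominated by the potential of \<open>a\<close>.\<close>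

lemma prob_code_exceeds_rank_at:
  assumes "1 \<le> j" "j \<le> s" "s < n"
  shows "measure_pmf.prob (codes q n) {c. rank_at c j s < c (Suc s)} \<le> 1 / (1 - q) * (1 - (1 - q) / 2) ^ (s - j)"
proof -
  have dep: "depends_on {1..Suc s} (\<lambda>c. of_bool (rank_at c j s < c (Suc s)) :: real)"
    unfolding depends_on_def
  proof (intro allI impI)
    fix c c' :: "nat \<Rightarrow> nat"
    assume eq: "\<forall>t\<in>{1..Suc s}. c t = c' t"
    have "rank_at c j s = rank_at c' j s"
      by (rule depends_onD[OF rank_at_depends]) (use eq assms in auto)
    then show "of_bool (rank_at c j s < c (Suc s)) = (of_bool (rank_at c' j s < c' (Suc s)) :: real)"
      using eq by simp
  qed
  have "measure_pmf.prob (codes q n) {c. rank_at c j s < c (Suc s)} =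
      measure_pmf.expectation (codes q (Suc s)) (\<lambda>c. of_bool (rank_at c j s < c (Suc s)))"
    using expectation_codes_marginal[OF dep, of n] assms(3) by (simp add: expectation_of_bool)
  also have "\<dots> = measure_pmf.expectation (codes q s) (\<lambda>c. measure_pmf.expectation (tgeom q (Suc s))
      (\<lambda>x. of_bool (rank_at c j s < x)))"
    unfolding expectation_codes_Suc using assms(2) by (simp add: rank_at_fun_upd)
  also have "\<dots> = measure_pmf.expectation (codes q s) (\<lambda>c. measure_pmf.prob (tgeom q (Suc s)) {rank_at c j s<..})"
    by (simp add: expectation_of_bool greaterThan_def)
  also have "\<dots> \<le> measure_pmf.expectation (codes q s) (\<lambda>c. potential (rank_at c j s))"
    by (intro integral_mono order.trans[OF prob_tgeom_greater_le potential_ge]) auto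
  also have "\<dots> \<le> 1 / (1 - q) * (1 - (1 - q) / 2) ^ (s - j)"
    by (rule expectation_potential_rank_at[OF assms(1,2)])
  finally show ?thesis .
qed

end

section \<open>Arrangements as blocks of consecutive ranks\<close>

text \<open>Ranks count from the top, so a value \<open>k1 + \<sigma> i\<close> becomes a rank \<open>b + l - \<sigma> i\<close>; moving \<open>\<sigma> i\<close> to the
left avoids truncated subtraction. The time \<open>t\<close> is a parameter because the event will be evaluated
before the permutation is complete.\<close>

definition block :: "nat \<Rightarrow> (nat \<Rightarrow> nat) set \<Rightarrow> nat \<Rightarrow> nat \<Rightarrow> (nat \<Rightarrow> nat) \<Rightarrow> bool" where
  "block l S k t c \<longleftrightarrow> (\<exists>b. \<exists>\<sigma>\<in>S. \<forall>i\<in>{1..l}. rank_at c (k + i) t + \<sigma> i = b + l)"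

lemma perms_range: "\<sigma> \<in> perms l \<Longrightarrow> i \<in> {1..l} \<Longrightarrow> \<sigma> i \<in> {1..l}"
  by (auto simp: perms_def dest: permutes_in_image)

lemma perms_surj: "\<sigma> \<in> perms l \<Longrightarrow> v \<in> {1..l} \<Longrightarrow> \<exists>i\<in>{1..l}. \<sigma> i = v"
  unfolding perms_def mem_Collect_eq by (metis imageE permutes_image)

lemma block_depends: "depends_on {k<..max (k + l) t} (block l S k t)"
  unfolding depends_on_def
proof (intro allI impI)
  fix c c' :: "nat \<Rightarrow> nat"
  assume eq: "\<forall>j\<in>{k<..max (k + l) t}. c j = c' j"
  have "rank_at c (k + i) t = rank_at c' (k + i) t" if "i \<in> {1..l}" for i
    by (rule depends_onD[OF rank_at_depends]) (use that eq in auto)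
  then show "block l S k t c = block l S k t c'" unfolding block_def by simp
qed

lemma has_arrangement_iff_block:
  assumes \<pi>: "\<pi> \<in> perms n" and S: "S \<subseteq> perms l" and l: "1 \<le> l" and k: "k + l \<le> n"
  shows "(\<exists>k1. k1 + l \<le> n \<and> has_arrangement l S k1 k \<pi>) \<longleftrightarrow> block l S k n (code n \<pi>)"
proof
  assume "\<exists>k1. k1 + l \<le> n \<and> has_arrangement l S k1 k \<pi>"
  then obtain k1 \<sigma> where h: "k1 + l \<le> n" "\<sigma> \<in> S" "\<And>i. i \<in> {1..l} \<Longrightarrow> \<pi> (k + i) = k1 + \<sigma> i"
    unfolding has_arrangement_def by blast
  have "rank_at (code n \<pi>) (k + i) n + \<sigma> i = (n - k1 - l) + l" if "i \<in> {1..l}" for i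
  proof -
    have "k + i \<in> {1..n}" using that k by auto
    from perm_eq_rank_at_code[OF \<pi> this] show ?thesis using h(3)[OF that] h(1) by auto
  qed
  then show "block l S k n (code n \<pi>)" unfolding block_def using h(2) by blast
next
  assume "block l S k n (code n \<pi>)"
  then obtain b \<sigma> where h: "\<sigma> \<in> S" "\<And>i. i \<in> {1..l} \<Longrightarrow> rank_at (code n \<pi>) (k + i) n + \<sigma> i = b + l"
    unfolding block_def by blast
  have e: "(n - \<pi> (k + i)) + \<sigma> i = b + l \<and> \<pi> (k + i) \<in> {1..n}" if "i \<in> {1..l}" for i
  proof -
    have "k + i \<in> {1..n}" using that k by auto
    from perm_eq_rank_at_code[OF \<pi> this] show ?thesis using h(2)[OF that] by auto
  qed
  obtain i1 where i1: "i1 \<in> {1..l}" "\<sigma> i1 = 1"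
    using perms_surj[OF subsetD[OF S h(1)], of 1] l by auto
  have bl: "b + l \<le> n" using e[OF i1(1)] i1(2) by auto
  have "\<pi> (k + i) = (n - b - l) + \<sigma> i" if "i \<in> {1..l}" for i
    using e[OF that] bl by auto
  then have "has_arrangement l S (n - b - l) k \<pi>" unfolding has_arrangement_def using h(1) by blast
  moreover have "(n - b - l) + l \<le> n" using bl by simp
  ultimately show "\<exists>k1. k1 + l \<le> n \<and> has_arrangement l S k1 k \<pi>" by blast
qed

lemma has_arrangement_unique:
  assumes "has_arrangement l S k1 k \<pi>" "has_arrangement l S k1' k \<pi>" "S \<subseteq> perms l" "1 \<le> l"
  shows "k1 \<le> k1'"
proof -
  from assms(1) obtain \<sigma> where s: "\<sigma> \<in> S" "\<And>i. i \<in> {1..l} \<Longrightarrow> \<pi> (k + i) = k1 + \<sigma> i"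
    unfolding has_arrangement_def by blast
  from assms(2) obtain \<tau> where t: "\<tau> \<in> S" "\<And>i. i \<in> {1..l} \<Longrightarrow> \<pi> (k + i) = k1' + \<tau> i"
    unfolding has_arrangement_def by blast
  obtain i where i: "i \<in> {1..l}" "\<tau> i = 1" using perms_surj[OF subsetD[OF assms(3) t(1)], of 1] assms(4) by auto
  have "\<sigma> i \<ge> 1" using perms_range[OF subsetD[OF assms(3) s(1)] i(1)] by simp
  then show ?thesis using s(2)[OF i(1)] t(2)[OF i(1)] i(2) by simp
qed

lemma Arr_eq_card_blocks:
  assumes \<pi>: "\<pi> \<in> perms n" and S: "S \<subseteq> perms l" and l: "1 \<le> l"
  shows "Arr n l S \<pi> = card {k \<in> {k. k + l \<le> n}. block l S k n (code n \<pi>)}"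
proof -
  let ?A = "{(k1, k2). k1 + l \<le> n \<and> k2 + l \<le> n \<and> has_arrangement l S k1 k2 \<pi>}"
  have "inj_on snd ?A"
  proof (rule inj_onI)
    fix x y assume "x \<in> ?A" "y \<in> ?A" and eq: "snd x = snd y"
    then have "has_arrangement l S (fst x) (snd y) \<pi>" "has_arrangement l S (fst y) (snd y) \<pi>" by auto
    then have "fst x = fst y" using has_arrangement_unique[OF _ _ S l] by (meson antisym)
    then show "x = y" using eq by (simp add: prod_eq_iff)
  qed
  then have "card ?A = card (snd ` ?A)" by (simp add: card_image)
  also have "snd ` ?A = {k \<in> {k. k + l \<le> n}. \<exists>k1. k1 + l \<le> n \<and> has_arrangement l S k1 k \<pi>}"
    by force
  also have "\<dots> = {k \<in> {k. k + l \<le> n}. block l S k n (code n \<pi>)}"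
    using has_arrangement_iff_block[OF \<pi> S l] by blast
  finally show ?thesis unfolding Arr_def .
qed

lemma rank_at_all_increase:
  assumes "j \<le> t1" "t1 \<le> t2" "\<And>s. t1 \<le> s \<Longrightarrow> s < t2 \<Longrightarrow> c (Suc s) \<le> rank_at c j s"
  shows "rank_at c j t2 = rank_at c j t1 + (t2 - t1)"
  using assms(2,3)
proof (induction t2 rule: dec_induct)
  case (step t)
  have "rank_at c j t = rank_at c j t1 + (t - t1)" by (rule step.IH) (use step.prems in auto)
  moreover have "c (Suc t) \<le> rank_at c j t" using step.prems[of t] step(1) by simp
  ultimately show ?case using step(1) assms(1) by (simp add: Suc_diff_le)
qed simp

text \<open>If every new code is at most all ranks of the block, all its ranks move up together.\<close>

lemma block_stable:
  assumes t: "k + l \<le> t1" "t1 \<le> t2" and S: "S \<subseteq> perms l" and l: "1 \<le> l"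
    and inc: "\<And>i s. i \<in> {1..l} \<Longrightarrow> t1 \<le> s \<Longrightarrow> s < t2 \<Longrightarrow> c (Suc s) \<le> rank_at c (k + i) s"
  shows "block l S k t2 c = block l S k t1 c"
proof -
  have eq: "rank_at c (k + i) t2 = rank_at c (k + i) t1 + (t2 - t1)" if "i \<in> {1..l}" for i
    using that t inc[OF that] by (intro rank_at_all_increase) auto
  show ?thesis
  proof
    assume "block l S k t2 c"
    then obtain b \<sigma> where h: "\<sigma> \<in> S" "\<And>i. i \<in> {1..l} \<Longrightarrow> rank_at c (k + i) t2 + \<sigma> i = b + l"
      unfolding block_def by blast
    obtain i0 where i0: "i0 \<in> {1..l}" "\<sigma> i0 = l" using perms_surj[OF subsetD[OF S h(1)], of l] l by auto
    have "b \<ge> t2 - t1" using h(2)[OF i0(1)] eq[OF i0(1)] i0(2) by simp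
    then have "rank_at c (k + i) t1 + \<sigma> i = (b - (t2 - t1)) + l" if "i \<in> {1..l}" for i
      using h(2)[OF that] eq[OF that] by simp
    then show "block l S k t1 c" unfolding block_def using h(1) by blast
  next
    assume "block l S k t1 c"
    then obtain b \<sigma> where h: "\<sigma> \<in> S" "\<And>i. i \<in> {1..l} \<Longrightarrow> rank_at c (k + i) t1 + \<sigma> i = b + l"
      unfolding block_def by blast
    have "rank_at c (k + i) t2 + \<sigma> i = (b + (t2 - t1)) + l" if "i \<in> {1..l}" for i
      using h(2)[OF that] eq[OF that] by simp
    then show "block l S k t2 c" unfolding block_def using h(1) by blast
  qed
qed

lemma (in mallows_param) prob_block_changes:
  assumes S: "S \<subseteq> perms l" and l: "1 \<le> l" and t: "k + l + m \<le> t" "t \<le> n"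
  shows "measure_pmf.prob (codes q n) {c. block l S k t c \<noteq> block l S k n c}
    \<le> real n * real l * (1 / (1 - q) * (1 - (1 - q) / 2) ^ m)"
proof -
  let ?e = "1 / (1 - q) * (1 - (1 - q) / 2) ^ m"
  have e0: "?e \<ge> 0" using q0 q1 by simp
  have sub: "{c. block l S k t c \<noteq> block l S k n c} \<subseteq>
      (\<Union>(s, i)\<in>{t..<n} \<times> {1..l}. {c. rank_at c (k + i) s < c (Suc s)})"
  proof
    fix c assume "c \<in> {c. block l S k t c \<noteq> block l S k n c}"
    then have neq: "block l S k n c \<noteq> block l S k t c" by auto
    have "\<exists>i s. i \<in> {1..l} \<and> t \<le> s \<and> s < n \<and> \<not> c (Suc s) \<le> rank_at c (k + i) s"
    proof (rule ccontr)
      assume "\<not> ?thesis"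
      then have "block l S k n c = block l S k t c"
        using t by (intro block_stable S l) auto
      with neq show False by simp
    qed
    then obtain i s where "i \<in> {1..l}" "s \<in> {t..<n}" "rank_at c (k + i) s < c (Suc s)" by auto
    then show "c \<in> (\<Union>(s, i)\<in>{t..<n} \<times> {1..l}. {c. rank_at c (k + i) s < c (Suc s)})" by blast
  qed
  have "measure_pmf.prob (codes q n) {c. block l S k t c \<noteq> block l S k n c} \<le>
      measure_pmf.prob (codes q n) (\<Union>x\<in>{t..<n} \<times> {1..l}. {c. rank_at c (k + snd x) (fst x) < c (Suc (fst x))})"
    using sub by (intro measure_pmf.finite_measure_mono) (auto simp: case_prod_unfold)
  also have "\<dots> \<le> (\<Sum>x\<in>{t..<n} \<times> {1..l}. measure_pmf.prob (codes q n) {c. rank_at c (k + snd x) (fst x) < c (Suc (fst x))})"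
    by (rule measure_pmf.finite_measure_subadditive_finite) auto
  also have "\<dots> \<le> (\<Sum>x\<in>{t..<n} \<times> {1..l}. ?e)"
  proof (rule sum_mono)
    fix x assume x: "x \<in> {t..<n} \<times> {1..l}"
    have "measure_pmf.prob (codes q n) {c. rank_at c (k + snd x) (fst x) < c (Suc (fst x))}
        \<le> 1 / (1 - q) * (1 - (1 - q) / 2) ^ (fst x - (k + snd x))"
      using x t by (intro prob_code_exceeds_rank_at) auto
    also have "\<dots> \<le> ?e"
      using x t q0 q1 by (intro mult_left_mono power_decreasing) auto
    finally show "measure_pmf.prob (codes q n) {c. rank_at c (k + snd x) (fst x) < c (Suc (fst x))} \<le> ?e" .
  qed
  also have "\<dots> = real (n - t) * real l * ?e" by (simp add: card_cartesian_product)
  also have "\<dots> \<le> real n * real l * ?e"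
    using e0 by (intro mult_right_mono) auto
  finally show ?thesis .
qed

lemma rank_at_bounds: "j \<le> t \<Longrightarrow> c j \<le> rank_at c j t \<and> rank_at c j t \<le> c j + (t - j)"
proof (induction t rule: dec_induct)
  case (step t)
  then show ?case by (auto simp: Suc_diff_le)
qed (simp add: rank_at_init)

section \<open>Upper bounds for one block and for two blocks\<close>

text \<open>Insertions never bring two ranks closer together. Hence ranks that are close at a late time come
from codes that are close.\<close>

lemma rank_at_gap_mono:
  assumes "j \<le> t" "j' \<le> t" "t \<le> t'" "rank_at c j t + d \<le> rank_at c j' t"
  shows "rank_at c j t' + d \<le> rank_at c j' t'"
  using assms(3)
proof (induction t' rule: dec_induct)
  case base
  show ?case by (rule assms(4))
next
  case (step s)
  have "j \<le> s" "j' \<le> s" using step(1) assms(1,2) by auto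
  then show ?case using step.IH by (auto simp: rank_at_Suc)
qed

lemma block_codes_close:
  assumes blk: "block l S k t c" and S: "S \<subseteq> perms l" and t: "k + l \<le> t"
    and i: "i \<in> {1..l}" "i' \<in> {1..l}"
  shows "c (k + i) < c (k + i') + 2 * l"
proof -
  obtain b \<sigma> where h: "\<sigma> \<in> S" "\<And>i. i \<in> {1..l} \<Longrightarrow> rank_at c (k + i) t + \<sigma> i = b + l"
    using blk unfolding block_def by blast
  define s where "s = max (k + i) (k + i')"
  have s: "k + i \<le> s" "k + i' \<le> s" "s \<le> t" "s \<le> k + l" using i t by (auto simp: s_def)
  have r: "\<sigma> i \<in> {1..l}" "\<sigma> i' \<in> {1..l}"
    using perms_range[OF subsetD[OF S h(1)]] i by auto
  have "rank_at c (k + i) s < rank_at c (k + i') s + l"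
  proof (rule ccontr)
    assume "\<not> ?thesis"
    then have "rank_at c (k + i') s + l \<le> rank_at c (k + i) s" by simp
    from rank_at_gap_mono[OF s(2,1,3) this] show False
      using h(2)[OF i(1)] h(2)[OF i(2)] r by auto
  qed
  moreover have "c (k + i) \<le> rank_at c (k + i) s" "rank_at c (k + i') s \<le> c (k + i') + (s - (k + i'))"
    using rank_at_bounds s(1,2) by blast+
  ultimately show ?thesis using s(4) i by auto
qed

definition near :: "nat \<Rightarrow> nat \<Rightarrow> nat \<Rightarrow> (nat \<Rightarrow> nat) \<Rightarrow> bool" where
  "near k s w c \<longleftrightarrow> (\<forall>i\<in>{1..s}. c (k + i) < c (k + 1) + w \<and> c (k + 1) < c (k + i) + w)"

lemma near_depends: "depends_on {k<..k + s} (near k s w)"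
  unfolding depends_on_def
proof (intro allI impI)
  fix c c' :: "nat \<Rightarrow> nat"
  assume eq: "\<forall>t\<in>{k<..k + s}. c t = c' t"
  have "c (k + i) = c' (k + i)" "c (k + 1) = c' (k + 1)" if "i \<in> {1..s}" for i
    using that eq by auto
  then show "near k s w c = near k s w c'" unfolding near_def by (metis (no_types, lifting))
qed

lemma block_imp_near:
  assumes "block l S k t c" "S \<subseteq> perms l" "k + l \<le> t" "1 \<le> l"
  shows "near k l (2 * l) c"
  unfolding near_def
proof
  fix i assume i: "i \<in> {1..l}"
  have l: "1 \<in> {1..l}" using assms(4) by simp
  show "c (k + i) < c (k + 1) + 2 * l \<and> c (k + 1) < c (k + i) + 2 * l"
    using block_codes_close[OF assms(1-3) i l] block_codes_close[OF assms(1-3) l i] by blast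
qed

text \<open>The second block contains the positions \<open>k + l\<close> and \<open>k + l + 1\<close>, so it ties one further code to the
\<open>l\<close> codes of the first block.\<close>

lemma overlapping_blocks_imp_near:
  assumes blk: "block l S k t c" "block l S k' t' c" and S: "S \<subseteq> perms l"
    and t: "k + l \<le> t" "k' + l \<le> t'" and k: "k < k'" "k' < k + l"
  shows "near k (Suc l) (4 * l) c"
  unfolding near_def
proof
  fix i assume i: "i \<in> {1..Suc l}"
  have l: "1 \<in> {1..l}" "l \<in> {1..l}" using k by auto
  note A = block_codes_close[OF blk(1) S t(1)] and B = block_codes_close[OF blk(2) S t(2)]
  show "c (k + i) < c (k + 1) + 4 * l \<and> c (k + 1) < c (k + i) + 4 * l"
  proof (cases "i = Suc l")
    case False
    then have "i \<in> {1..l}" using i by auto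
    from A[OF this l(1)] A[OF l(1) this] show ?thesis by linarith
  next
    case True
    have m: "k + l - k' \<in> {1..l}" "Suc (k + l - k') \<in> {1..l}" using k by auto
    have e: "k' + (k + l - k') = k + l" "k' + Suc (k + l - k') = k + i" using k True by auto
    from B[OF m(1) m(2)] B[OF m(2) m(1)] A[OF l] A[OF l(2) l(1)] show ?thesis
      unfolding e by linarith
  qed
qed

context mallows_param
begin

lemma prob_codes_mono:
  "(\<And>c. P c \<Longrightarrow> Q c) \<Longrightarrow> measure_pmf.prob (codes q n) {c. P c} \<le> measure_pmf.prob (codes q n) {c. Q c}"
  by (intro measure_pmf.finite_measure_mono) auto

text \<open>Once \<open>q ^ t \<le> 1/2\<close>, truncation at most doubles the point probabilities.\<close>

lemma prob_tgeom_window: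
  assumes t: "1 \<le> t" "q ^ t \<le> 1 / 2"
  shows "measure_pmf.prob (tgeom q t) {x. x < a + w \<and> a < x + w} \<le> 4 * real w * (1 - q)"
proof -
  have fin: "finite {x. x < a + w \<and> a < x + w}" by (rule finite_subset[of _ "{..<a + w}"]) auto
  have card: "card {x. x < a + w \<and> a < x + w} \<le> 2 * w"
  proof -
    have "{x. x < a + w \<and> a < x + w} \<subseteq> {a - w..<a + w}" by auto
    then have "card {x. x < a + w \<and> a < x + w} \<le> card {a - w..<a + w}" by (intro card_mono) auto
    then show ?thesis by simp
  qed
  have "measure_pmf.prob (tgeom q t) {x. x < a + w \<and> a < x + w} =
      (\<Sum>x\<in>{x. x < a + w \<and> a < x + w}. pmf (tgeom q t) x)"
    by (rule measure_measure_pmf_finite[OF fin])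
  also have "\<dots> \<le> (\<Sum>x\<in>{x. x < a + w \<and> a < x + w}. 2 * (1 - q))"
  proof (rule sum_mono)
    fix x
    have "pmf (tgeom q t) x \<le> (1 - q) / (1 - q ^ t)" by (rule pmf_tgeom_le[OF t(1)])
    also have "\<dots> \<le> (1 - q) / (1 / 2)" using t q1 by (intro divide_left_mono) auto
    finally show "pmf (tgeom q t) x \<le> 2 * (1 - q)" by simp
  qed
  also have "\<dots> = real (card {x. x < a + w \<and> a < x + w}) * (2 * (1 - q))" by simp
  also have "\<dots> \<le> real (2 * w) * (2 * (1 - q))"
    using card q1 by (intro mult_right_mono) (simp_all only: of_nat_le_iff, simp)
  finally show ?thesis by (simp add: algebra_simps)
qed

lemma prob_near:
  assumes s: "1 \<le> s" "k + s \<le> n" and k: "q ^ k \<le> 1 / 2"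
  shows "measure_pmf.prob (codes q n) {c. near k s w c} \<le> (4 * real w * (1 - q)) ^ (s - 1)"
proof -
  have dep: "depends_on {1..k + s} (\<lambda>c. of_bool (near k s w c) :: real)" for s
    by (rule depends_on_compose[OF depends_on_mono[OF near_depends]]) auto
  have "measure_pmf.expectation (codes q (k + s)) (\<lambda>c. of_bool (near k s w c)) \<le> (4 * real w * (1 - q)) ^ (s - 1)"
    using s(1)
  proof (induction s rule: dec_induct)
    case base
    show ?case by (simp add: expectation_of_bool)
  next
    case (step s)
    have upd: "near k (Suc s) w (c(Suc (k + s) := x)) \<longleftrightarrow>
        near k s w c \<and> x < c (k + 1) + w \<and> c (k + 1) < x + w" for c x
    proof -
      have "near k s w (c(Suc (k + s) := x)) = near k s w c"
        by (rule depends_onD[OF near_depends]) auto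
      moreover have "near k (Suc s) w d \<longleftrightarrow>
          near k s w d \<and> d (k + Suc s) < d (k + 1) + w \<and> d (k + 1) < d (k + Suc s) + w" for d
      proof -
        have "{1..Suc s} = insert (Suc s) {1..s}" by auto
        then show ?thesis unfolding near_def by (simp only: ball_simps(7)) blast
      qed
      ultimately show ?thesis using step(1) by simp
    qed
    have "measure_pmf.expectation (codes q (k + Suc s)) (\<lambda>c. of_bool (near k (Suc s) w c)) =
        measure_pmf.expectation (codes q (k + s)) (\<lambda>c. measure_pmf.expectation (tgeom q (Suc (k + s)))
          (\<lambda>x. of_bool (near k s w c) * of_bool (x < c (k + 1) + w \<and> c (k + 1) < x + w) :: real))"
      unfolding add_Suc_right expectation_codes_Suc upd by (simp only: of_bool_conj)
    also have "\<dots> \<le> measure_pmf.expectation (codes q (k + s)) (\<lambda>c. of_bool (near k s w c) * (4 * real w * (1 - q)))"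
    proof (rule integral_mono)
      fix c
      have "q ^ Suc (k + s) \<le> q ^ k" using q0 q1 by (intro power_decreasing) auto
      then have "q ^ Suc (k + s) \<le> 1 / 2" using k by linarith
      then have "measure_pmf.prob (tgeom q (Suc (k + s))) {x. x < c (k + 1) + w \<and> c (k + 1) < x + w} \<le> 4 * real w * (1 - q)"
        by (intro prob_tgeom_window) auto
      then show "measure_pmf.expectation (tgeom q (Suc (k + s)))
          (\<lambda>x. of_bool (near k s w c) * of_bool (x < c (k + 1) + w \<and> c (k + 1) < x + w))
          \<le> of_bool (near k s w c) * (4 * real w * (1 - q))"
        unfolding integral_mult_right_zero expectation_of_bool by (intro mult_left_mono) auto
    qed auto
    also have "\<dots> = measure_pmf.expectation (codes q (k + s)) (\<lambda>c. of_bool (near k s w c)) * (4 * real w * (1 - q))"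
      by simp
    also have "\<dots> \<le> (4 * real w * (1 - q)) ^ (s - 1) * (4 * real w * (1 - q))"
      using q1 by (intro mult_right_mono step.IH) auto
    also have "\<dots> = (4 * real w * (1 - q)) ^ (Suc s - 1)"
      using step(1) by (cases s) auto
    finally show ?case .
  qed
  then show ?thesis
    using expectation_codes_marginal[OF dep s(2)] by (simp only: expectation_of_bool)
qed

lemma prob_block_le:
  assumes "S \<subseteq> perms l" "1 \<le> l" "k + l \<le> t" "k + l \<le> n" "q ^ k \<le> 1 / 2"
  shows "measure_pmf.prob (codes q n) {c. block l S k t c} \<le> (8 * real l * (1 - q)) ^ (l - 1)"
proof -
  have "measure_pmf.prob (codes q n) {c. block l S k t c} \<le> measure_pmf.prob (codes q n) {c. near k l (2 * l) c}"
    by (rule prob_codes_mono) (rule block_imp_near[OF _ assms(1,3,2)])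
  also have "\<dots> \<le> (4 * real (2 * l) * (1 - q)) ^ (l - 1)"
    by (rule prob_near) (use assms in auto)
  finally show ?thesis by simp
qed

lemma prob_two_blocks_overlap:
  assumes "S \<subseteq> perms l" "k + l \<le> t" "k' + l \<le> t'" "k < k'" "k' < k + l" "k' + l \<le> n" "q ^ k \<le> 1 / 2"
  shows "measure_pmf.prob (codes q n) {c. block l S k t c \<and> block l S k' t' c} \<le> (16 * real l * (1 - q)) ^ l"
proof -
  have "measure_pmf.prob (codes q n) {c. block l S k t c \<and> block l S k' t' c} \<le>
      measure_pmf.prob (codes q n) {c. near k (Suc l) (4 * l) c}"
    by (rule prob_codes_mono) (use overlapping_blocks_imp_near[OF _ _ assms(1-5)] in blast)
  also have "\<dots> \<le> (4 * real (4 * l) * (1 - q)) ^ (Suc l - 1)"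
    by (rule prob_near) (use assms in auto)
  finally show ?thesis by simp
qed

lemma prob_two_blocks_disjoint:
  assumes "S \<subseteq> perms l" "1 \<le> l" "k + l \<le> t" "k' + l \<le> t'" "k + l \<le> k'" "k' + l \<le> n" "q ^ k \<le> 1 / 2"
  shows "measure_pmf.prob (codes q n) {c. block l S k t c \<and> block l S k' t' c}
    \<le> (8 * real l * (1 - q)) ^ (l - 1) * (8 * real l * (1 - q)) ^ (l - 1)"
proof -
  let ?X = "\<lambda>c. of_bool (near k l (2 * l) c) :: real" and ?Y = "\<lambda>c. of_bool (near k' l (2 * l) c) :: real"
  have k': "q ^ k' \<le> 1 / 2"
    using power_decreasing[of k k' q] q0 q1 assms(5,7) by linarith
  have "measure_pmf.prob (codes q n) {c. block l S k t c \<and> block l S k' t' c} \<le>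
      measure_pmf.prob (codes q n) {c. near k l (2 * l) c \<and> near k' l (2 * l) c}"
    by (rule prob_codes_mono) (use block_imp_near[OF _ assms(1)] assms in blast)
  also have "\<dots> = measure_pmf.expectation (codes q n) (\<lambda>c. ?X c * ?Y c)"
    by (simp only: expectation_of_bool of_bool_conj[symmetric])
  also have "\<dots> = measure_pmf.expectation (codes q n) ?X * measure_pmf.expectation (codes q n) ?Y"
  proof (rule expectation_codes_mult)
    show "depends_on {k<..k + l} ?X"
      by (rule depends_on_compose[OF near_depends])
    show "depends_on (- {k<..k + l}) ?Y"
      by (rule depends_on_compose[OF depends_on_mono[OF near_depends]]) (use assms(5) in auto)
  qed
  also have "\<dots> \<le> (4 * real (2 * l) * (1 - q)) ^ (l - 1) * (4 * real (2 * l) * (1 - q)) ^ (l - 1)"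
    unfolding expectation_of_bool
    by (intro mult_mono prob_near) (use assms k' q1 in auto)
  finally show ?thesis by simp
qed

section \<open>A lower bound for the probability of a block\<close>

text \<open>For untruncated geometric codes and in the limit of infinitely many further insertions, this is
the probability that a block with lowest rank \<open>b\<close> is never broken up.\<close>

definition survival :: "nat \<Rightarrow> nat \<Rightarrow> real" where
  "survival l b = (\<Prod>j\<in>{1..<l}. 1 - q ^ (b + j))"

lemma survival_nonneg: "survival l b \<ge> 0"
  unfolding survival_def using one_minus_pow_pos by (intro prod_nonneg) (auto intro!: less_imp_le)

lemma survival_le_1: "survival l b \<le> 1"
  unfolding survival_def using one_minus_pow_pos q0 by (intro prod_le_1) (auto intro!: less_imp_le)

lemma survival_shift:
  assumes "1 \<le> l"
  shows "(1 - q ^ (b + 1)) * survival l (Suc b) = survival l b * (1 - q ^ (b + l))"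
proof -
  have "(\<Prod>j\<in>{1..<Suc l}. 1 - q ^ (b + j)) = survival l b * (1 - q ^ (b + l))"
    using assms by (simp add: survival_def)
  moreover have "(\<Prod>j\<in>{1..<Suc l}. 1 - q ^ (b + j)) = (1 - q ^ (b + 1)) * (\<Prod>j\<in>{Suc 1..<Suc l}. 1 - q ^ (b + j))"
    using assms by (subst prod.atLeast_Suc_lessThan) auto
  moreover have "(\<Prod>j\<in>{Suc 1..<Suc l}. 1 - q ^ (b + j)) = survival l (Suc b)"
    unfolding survival_def by (subst prod.atLeast_Suc_lessThan_Suc_shift) simp
  ultimately show ?thesis by simp
qed

text \<open>A new code \<open>x \<le> b\<close> lifts the block, a code \<open>x \<ge> b + l\<close> leaves it alone, and the codes in between
break it. Harmonicity is exact also for the truncated law, since conditioning on \<open>x < t\<close> only removes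
part of the event that leaves the block unchanged.\<close>

lemma expectation_survival_step:
  assumes "1 \<le> l" "b + l \<le> t"
  shows "measure_pmf.expectation (tgeom q t) (\<lambda>x. of_bool (x \<le> b) * survival l (Suc b) + of_bool (b + l \<le> x) * survival l b)
    = survival l b"
proof -
  have t: "1 \<le> t" using assms by simp
  have "{x. x \<le> b} = {..<b + 1}" "{x. b + l \<le> x} = UNIV - {..<b + l}" by auto
  then have "measure_pmf.expectation (tgeom q t) (\<lambda>x. of_bool (x \<le> b) * survival l (Suc b) + of_bool (b + l \<le> x) * survival l b)
    = (1 - q ^ (b + 1)) / (1 - q ^ t) * survival l (Suc b) + (1 - (1 - q ^ (b + l)) / (1 - q ^ t)) * survival l b"
    unfolding expectation_tgeom_of_bool[OF t]
    using prob_tgeom_lessThan[OF t, of "b + 1"] prob_tgeom_lessThan[OF t, of "b + l"]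
      measure_pmf.prob_compl[of "{..<b + l}" "tgeom q t"] assms by simp
  also have "\<dots> = ((1 - q ^ (b + 1)) * survival l (Suc b)) / (1 - q ^ t) + (1 - (1 - q ^ (b + l)) / (1 - q ^ t)) * survival l b"
    by simp
  also have "\<dots> = survival l b"
    unfolding survival_shift[OF assms(1)] by (simp add: algebra_simps)
  finally show ?thesis .
qed

lemma rank_at_less:
  assumes "c \<in> set_pmf (codes q t)" "1 \<le> j" "j \<le> t"
  shows "rank_at c j t < t"
proof -
  have "c j < j" using assms by (simp add: set_codes PiE_dflt_def)
  then show ?thesis using rank_at_bounds[OF assms(3), of c] assms(3) by linarith
qed

end

text \<open>The block event for one \<open>\<sigma>\<close>, with the free lowest rank \<open>b\<close> replaced by the rank at the index \<open>i0\<close>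
where \<open>\<sigma>\<close> takes its maximum \<open>l\<close>; this makes \<open>b\<close> a function of the codes.\<close>

definition pattern :: "nat \<Rightarrow> (nat \<Rightarrow> nat) \<Rightarrow> nat \<Rightarrow> nat \<Rightarrow> nat \<Rightarrow> (nat \<Rightarrow> nat) \<Rightarrow> bool" where
  "pattern l \<sigma> i0 k t c \<longleftrightarrow> (\<forall>i\<in>{1..l}. rank_at c (k + i) t + \<sigma> i = rank_at c (k + i0) t + l)"

lemma pattern_step_up:
  assumes p: "pattern l \<sigma> i0 k t c" and \<sigma>: "\<sigma> \<in> perms l" and t: "k + l \<le> t"
    and i0: "i0 \<in> {1..l}" and x: "x \<le> rank_at c (k + i0) t"
  shows "pattern l \<sigma> i0 k (Suc t) (c(Suc t := x)) \<and> rank_at (c(Suc t := x)) (k + i0) (Suc t) = Suc (rank_at c (k + i0) t)"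
proof -
  have "rank_at (c(Suc t := x)) (k + i) (Suc t) = Suc (rank_at c (k + i) t)" if "i \<in> {1..l}" for i
  proof -
    have "rank_at c (k + i) t + \<sigma> i = rank_at c (k + i0) t + l" using p that unfolding pattern_def by blast
    then have "x \<le> rank_at c (k + i) t" using perms_range[OF \<sigma> that] x by auto
    then show ?thesis using that t by (subst rank_at_Suc_fun_upd) auto
  qed
  then show ?thesis using p i0 unfolding pattern_def by simp
qed

lemma pattern_step_stay:
  assumes p: "pattern l \<sigma> i0 k t c" and \<sigma>: "\<sigma> \<in> perms l" and t: "k + l \<le> t"
    and i0: "i0 \<in> {1..l}" and x: "rank_at c (k + i0) t + l \<le> x"
  shows "pattern l \<sigma> i0 k (Suc t) (c(Suc t := x)) \<and> rank_at (c(Suc t := x)) (k + i0) (Suc t) = rank_at c (k + i0) t"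
proof -
  have "rank_at (c(Suc t := x)) (k + i) (Suc t) = rank_at c (k + i) t" if "i \<in> {1..l}" for i
  proof -
    have "rank_at c (k + i) t + \<sigma> i = rank_at c (k + i0) t + l" using p that unfolding pattern_def by blast
    then have "\<not> x \<le> rank_at c (k + i) t" using perms_range[OF \<sigma> that] x by auto
    then show ?thesis using that t by (subst rank_at_Suc_fun_upd) auto
  qed
  then show ?thesis using p i0 unfolding pattern_def by simp
qed

text \<open>The survival function evaluated along the process does not decrease in mean, and it is at most 1.\<close>

lemma (in mallows_param) prob_pattern_ge:
  assumes \<sigma>: "\<sigma> \<in> perms l" and l: "1 \<le> l" and i0: "i0 \<in> {1..l}" and t: "k + l \<le> t"
  shows "measure_pmf.expectation (codes q (k + l)) (\<lambda>c. of_bool (pattern l \<sigma> i0 k (k + l) c) * survival l (rank_at c (k + i0) (k + l)))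
    \<le> measure_pmf.prob (codes q t) {c. pattern l \<sigma> i0 k t c}"
proof -
  let ?G = "\<lambda>t c. of_bool (pattern l \<sigma> i0 k t c) * survival l (rank_at c (k + i0) t)"
  have mono: "measure_pmf.expectation (codes q (k + l)) (?G (k + l)) \<le> measure_pmf.expectation (codes q t) (?G t)"
    using t
  proof (induction t rule: dec_induct)
    case (step t)
    have "measure_pmf.expectation (codes q t) (?G t) \<le> measure_pmf.expectation (codes q (Suc t)) (?G (Suc t))"
      unfolding expectation_codes_Suc
    proof (rule integral_mono_AE)
      show "AE c in measure_pmf (codes q t). ?G t c \<le> measure_pmf.expectation (tgeom q (Suc t)) (\<lambda>x. ?G (Suc t) (c(Suc t := x)))"
        unfolding AE_measure_pmf_iff
      proof
        fix c assume c: "c \<in> set_pmf (codes q t)"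
        show "?G t c \<le> measure_pmf.expectation (tgeom q (Suc t)) (\<lambda>x. ?G (Suc t) (c(Suc t := x)))"
        proof (cases "pattern l \<sigma> i0 k t c")
          case False
          have "0 \<le> measure_pmf.expectation (tgeom q (Suc t)) (\<lambda>x. ?G (Suc t) (c(Suc t := x)))"
            by (rule integral_nonneg_AE) (simp add: survival_nonneg)
          then show ?thesis using False by simp
        next
          case True
          define b where "b = rank_at c (k + i0) t"
          obtain i1 where i1: "i1 \<in> {1..l}" "\<sigma> i1 = 1" using perms_surj[OF \<sigma>, of 1] l by auto
          have "rank_at c (k + i1) t + \<sigma> i1 = b + l" using True i1(1) unfolding pattern_def b_def by blast
          moreover have "rank_at c (k + i1) t < t" using c i1(1) step(1) by (intro rank_at_less) auto
          ultimately have bl: "b + l \<le> Suc t" using i1(2) by simp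
          have "?G t c = survival l b" using True by (simp add: b_def)
          also have "\<dots> = measure_pmf.expectation (tgeom q (Suc t))
              (\<lambda>x. of_bool (x \<le> b) * survival l (Suc b) + of_bool (b + l \<le> x) * survival l b)"
            by (rule expectation_survival_step[OF l bl, symmetric])
          also have "\<dots> \<le> measure_pmf.expectation (tgeom q (Suc t)) (\<lambda>x. ?G (Suc t) (c(Suc t := x)))"
          proof (rule integral_mono)
            fix x
            show "of_bool (x \<le> b) * survival l (Suc b) + of_bool (b + l \<le> x) * survival l b \<le> ?G (Suc t) (c(Suc t := x))"
            proof (cases "x \<le> b")
              case le: True
              then show ?thesis
                using pattern_step_up[OF True \<sigma> step(1) i0, of x] l by (simp only: b_def[symmetric]) simp
            next
              case False
              show ?thesis
              proof (cases "b + l \<le> x")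
                case le: True
                then show ?thesis
                  using pattern_step_stay[OF True \<sigma> step(1) i0, of x] False by (simp only: b_def[symmetric]) simp
              next
                case nle: False
                then show ?thesis using False by (simp only: of_bool_eq mult_zero_left add_0) (simp add: survival_nonneg)
              qed
            qed
          qed auto
          finally show ?thesis .
        qed
      qed
    qed auto
    with step.IH show ?case by simp
  qed simp
  also have "\<dots> \<le> measure_pmf.expectation (codes q t) (\<lambda>c. of_bool (pattern l \<sigma> i0 k t c))"
    by (intro integral_mono) (auto simp: survival_le_1 mult_left_le)
  finally show ?thesis by (simp only: expectation_of_bool)
qed

text \<open>Adding a constant to the codes of the block adds it to its ranks, as only comparisons matter. So the
codes of \<open>\<sigma>\<close>, shifted by \<open>b\<close>, produce the pattern \<open>\<sigma>\<close> with lowest rank \<open>b\<close>.\<close>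

lemma rank_at_shifted_code:
  assumes c: "\<And>i. i \<in> {1..l} \<Longrightarrow> c (k + i) = b + d i" and i: "1 \<le> i" "i \<le> s" "s \<le> l"
  shows "rank_at c (k + i) (k + s) = b + rank_at d i s"
  using i(2,3)
proof (induction s rule: dec_induct)
  case base
  show ?case using c[of i] i by (simp add: rank_at_init)
next
  case (step s)
  have "c (k + Suc s) = b + d (Suc s)" using step.prems by (intro c) auto
  then show ?case using step by (simp only: add_Suc_right rank_at_Suc[of "k + i" "k + s"] rank_at_Suc[of i s]) simp
qed

context mallows_param
begin

lemma prob_codes_values_ge:
  assumes "k + l \<le> n" "\<And>i. i \<in> {1..l} \<Longrightarrow> v i < k + i \<and> v i \<le> w"
  shows "measure_pmf.prob (codes q n) {c. \<forall>i\<in>{1..l}. c (k + i) = v i} \<ge> ((1 - q) * q ^ w) ^ l"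
proof -
  define B where "B x = (if x \<in> {k + 1..k + l} then {v (x - k)} else UNIV)" for x
  have "((1 - q) * q ^ w) ^ l = (\<Prod>x\<in>{k + 1..k + l}. (1 - q) * q ^ w)" by simp
  also have "\<dots> \<le> (\<Prod>x\<in>{k + 1..k + l}. measure_pmf.prob (tgeom q x) (B x))"
  proof (rule prod_mono)
    fix x assume x: "x \<in> {k + 1..k + l}"
    then have "x - k \<in> {1..l}" "k + (x - k) = x" by auto
    then have v: "v (x - k) < x" "v (x - k) \<le> w" using assms(2)[of "x - k"] by simp_all
    have "(1 - q) * q ^ w \<le> (1 - q) * q ^ v (x - k)"
      using v q0 q1 by (intro mult_left_mono power_decreasing) auto
    also have "\<dots> \<le> pmf (tgeom q x) (v (x - k))" by (rule pmf_tgeom_ge[OF v(1)])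
    finally show "0 \<le> (1 - q) * q ^ w \<and> (1 - q) * q ^ w \<le> measure_pmf.prob (tgeom q x) (B x)"
      using x q0 q1 by (simp add: B_def measure_pmf_single)
  qed
  also have "\<dots> = (\<Prod>x\<in>{1..n}. measure_pmf.prob (tgeom q x) (B x))"
    using assms(1) by (intro prod.mono_neutral_left) (auto simp: B_def)
  also have "\<dots> = measure_pmf.prob (codes q n) (Pi {1..n} B)"
    unfolding codes_def by (rule measure_Pi_pmf_Pi[symmetric]) auto
  also have "\<dots> \<le> measure_pmf.prob (codes q n) {c. \<forall>i\<in>{1..l}. c (k + i) = v i}"
  proof (rule measure_pmf.finite_measure_mono)
    show "Pi {1..n} B \<subseteq> {c. \<forall>i\<in>{1..l}. c (k + i) = v i}"
    proof (intro subsetI CollectI ballI)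
      fix c i assume c: "c \<in> Pi {1..n} B" and i: "i \<in> {1..l}"
      have "c (k + i) \<in> B (k + i)" using assms(1) i by (intro Pi_mem[OF c]) auto
      then show "c (k + i) = v i" using i by (simp add: B_def)
    qed
  qed simp
  finally show ?thesis .
qed

text \<open>Sum over the lowest rank \<open>b\<close> right after the block is complete, restricted to \<open>m \<le> b < 2 m\<close>. In the
application \<open>m\<close> is about \<open>1 / (1 - q)\<close>, so both \<open>q ^ b\<close> and \<open>1 - q ^ b\<close> are bounded away from 0.\<close>

lemma prob_block_ge:
  assumes \<sigma>: "\<sigma> \<in> S" "S \<subseteq> perms l" and l: "1 \<le> l" and n: "k + l \<le> n"
    and m: "1 \<le> m" "2 * m \<le> k"
  shows "measure_pmf.prob (codes q n) {c. block l S k n c} \<ge>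
    real m * (((1 - q) * q ^ (2 * m + l)) ^ l * (1 - q ^ m) ^ (l - 1))"
proof -
  have \<sigma>l: "\<sigma> \<in> perms l" using \<sigma> by blast
  obtain i0 where i0: "i0 \<in> {1..l}" "\<sigma> i0 = l" using perms_surj[OF \<sigma>l, of l] l by auto
  define d where "d = code l \<sigma>"
  define Z where "Z b c \<longleftrightarrow> (\<forall>i\<in>{1..l}. c (k + i) = b + d i)" for b and c :: "nat \<Rightarrow> nat"
  let ?G = "\<lambda>c. of_bool (pattern l \<sigma> i0 k (k + l) c) * survival l (rank_at c (k + i0) (k + l))"
  have d_less: "d i < i" if "i \<in> {1..l}" for i
  proof -
    have "d \<in> PiE_dflt {1..l} 0 lessThan"
      unfolding d_def by (rule bij_betw_apply[OF bij_betw_code \<sigma>l])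
    then show ?thesis using that by (simp add: PiE_dflt_def)
  qed
  have Zp: "pattern l \<sigma> i0 k (k + l) c \<and> rank_at c (k + i0) (k + l) = b" if "Z b c" for b c
  proof -
    have "rank_at c (k + i) (k + l) = b + (l - \<sigma> i)" if i: "i \<in> {1..l}" for i
    proof -
      have "rank_at c (k + i) (k + l) = b + rank_at d i l"
        using \<open>Z b c\<close> i unfolding Z_def by (intro rank_at_shifted_code[where l = l]) auto
      also have "rank_at d i l = l - \<sigma> i" unfolding d_def using perm_eq_rank_at_code[OF \<sigma>l i] by simp
      finally show ?thesis .
    qed
    then have e: "rank_at c (k + i) (k + l) + \<sigma> i = b + l" if "i \<in> {1..l}" for i
      using perms_range[OF \<sigma>l that] that by simp
    moreover have "rank_at c (k + i0) (k + l) = b" using e[OF i0(1)] i0(2) by simp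
    ultimately show ?thesis unfolding pattern_def by blast
  qed
  have "real m * (((1 - q) * q ^ (2 * m + l)) ^ l * (1 - q ^ m) ^ (l - 1)) =
      (\<Sum>b\<in>{m..<2 * m}. ((1 - q) * q ^ (2 * m + l)) ^ l * (1 - q ^ m) ^ (l - 1))" by simp
  also have "\<dots> \<le> (\<Sum>b\<in>{m..<2 * m}. measure_pmf.prob (codes q (k + l)) {c. Z b c} * survival l b)"
  proof (rule sum_mono)
    fix b assume b: "b \<in> {m..<2 * m}"
    have "((1 - q) * q ^ (2 * m + l)) ^ l \<le> measure_pmf.prob (codes q (k + l)) {c. Z b c}"
      unfolding Z_def
    proof (rule prob_codes_values_ge)
      fix i assume i: "i \<in> {1..l}"
      show "b + d i < k + i \<and> b + d i \<le> 2 * m + l" using d_less[OF i] i b m by auto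
    qed simp
    moreover have "(1 - q ^ m) ^ (l - 1) \<le> survival l b"
    proof -
      have "(1 - q ^ m) ^ (l - 1) = (\<Prod>j\<in>{1..<l}. 1 - q ^ m)" by simp
      also have "\<dots> \<le> survival l b" unfolding survival_def
        using b q0 q1 one_minus_pow_pos[OF m(1)] by (intro prod_mono) (auto intro!: power_decreasing)
      finally show ?thesis .
    qed
    ultimately show "((1 - q) * q ^ (2 * m + l)) ^ l * (1 - q ^ m) ^ (l - 1)
        \<le> measure_pmf.prob (codes q (k + l)) {c. Z b c} * survival l b"
      using one_minus_pow_pos[OF m(1)] by (intro mult_mono) auto
  qed
  also have "\<dots> = measure_pmf.expectation (codes q (k + l)) (\<lambda>c. \<Sum>b\<in>{m..<2 * m}. of_bool (Z b c) * survival l b)"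
    by (subst Bochner_Integration.integral_sum) (simp_all add: expectation_of_bool)
  also have "\<dots> \<le> measure_pmf.expectation (codes q (k + l)) ?G"
  proof (rule integral_mono)
    fix c
    show "(\<Sum>b\<in>{m..<2 * m}. of_bool (Z b c) * survival l b) \<le> ?G c"
    proof (cases "\<exists>b. Z b c")
      case False
      then show ?thesis by (simp add: survival_nonneg)
    next
      case True
      then obtain b where b: "Z b c" by blast
      have uniq: "b' = b" if "Z b' c" for b' using Zp[OF that] Zp[OF b] by simp
      have "(\<Sum>b\<in>{m..<2 * m}. of_bool (Z b c) * survival l b) \<le> (\<Sum>b'\<in>{m..<2 * m}. if b' = b then survival l b else 0)"
      proof (rule sum_mono)
        fix b'
        show "of_bool (Z b' c) * survival l b' \<le> (if b' = b then survival l b else 0)"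
          using uniq[of b'] b by (cases "Z b' c") (simp_all add: survival_nonneg)
      qed
      also have "\<dots> \<le> survival l b" by (simp add: survival_nonneg)
      also have "\<dots> = ?G c" using Zp[OF b] by simp
      finally show ?thesis .
    qed
  qed auto
  also have "\<dots> \<le> measure_pmf.prob (codes q n) {c. pattern l \<sigma> i0 k n c}"
    by (rule prob_pattern_ge[OF \<sigma>l l i0(1) n])
  also have "\<dots> \<le> measure_pmf.prob (codes q n) {c. block l S k n c}"
    by (rule prob_codes_mono) (use \<sigma>(1) in \<open>unfold pattern_def block_def, blast\<close>)
  finally show ?thesis .
qed

end

section \<open>Reversal and the first positions\<close>

definition reversal :: "nat \<Rightarrow> (nat \<Rightarrow> nat) \<Rightarrow> nat \<Rightarrow> nat" where
  "reversal n \<pi> i = (if i \<in> {1..n} then n + 1 - \<pi> (n + 1 - i) else i)"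

lemma reversal_perms:
  assumes "\<pi> \<in> perms n"
  shows "reversal n \<pi> \<in> perms n"
proof -
  have r: "\<pi> i \<in> {1..n}" if "i \<in> {1..n}" for i using perms_range[OF assms that] .
  have inj: "inj_on \<pi> {1..n}" using assms by (auto simp: perms_def intro: permutes_inj_on)
  have "inj_on (reversal n \<pi>) {1..n}"
  proof (rule inj_onI)
    fix i j assume ij: "i \<in> {1..n}" "j \<in> {1..n}" "reversal n \<pi> i = reversal n \<pi> j"
    have m: "n + 1 - i \<in> {1..n}" "n + 1 - j \<in> {1..n}" using ij by auto
    have "n + 1 - \<pi> (n + 1 - i) = n + 1 - \<pi> (n + 1 - j)" using ij by (simp only: reversal_def if_True)
    then have "\<pi> (n + 1 - i) = \<pi> (n + 1 - j)" using r[OF m(1)] r[OF m(2)] unfolding atLeastAtMost_iff by arith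
    then have "n + 1 - i = n + 1 - j" using inj_onD[OF inj _ m] by blast
    then show "i = j" using ij by auto
  qed
  moreover have "reversal n \<pi> ` {1..n} \<subseteq> {1..n}"
  proof
    fix x assume "x \<in> reversal n \<pi> ` {1..n}"
    then obtain i where i: "i \<in> {1..n}" "x = reversal n \<pi> i" by blast
    have "n + 1 - i \<in> {1..n}" using i by auto
    from r[OF this] show "x \<in> {1..n}" using i by (auto simp: reversal_def)
  qed
  ultimately have "bij_betw (reversal n \<pi>) {1..n} {1..n}"
    by (simp add: bij_betw_def endo_inj_surj)
  then show ?thesis unfolding perms_def
    by (auto intro!: bij_imp_permutes simp: reversal_def)
qed

lemma reversal_reversal:
  assumes "\<pi> \<in> perms n"
  shows "reversal n (reversal n \<pi>) = \<pi>"
proof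
  fix i
  show "reversal n (reversal n \<pi>) i = \<pi> i"
  proof (cases "i \<in> {1..n}")
    case True
    then have "n + 1 - i \<in> {1..n}" "n + 1 - (n + 1 - i) = i" by auto
    then show ?thesis using True perms_range[OF assms True] by (simp add: reversal_def)
  next
    case False
    then show ?thesis using assms by (auto simp: reversal_def perms_def permutes_def)
  qed
qed

lemma inv_count_reversal:
  assumes "\<pi> \<in> perms n"
  shows "inv_count n (reversal n \<pi>) = inv_count n \<pi>"
proof -
  let ?m = "\<lambda>(i, j). (n + 1 - j, n + 1 - i)"
  have flip: "\<pi> (n + 1 - j) > \<pi> (n + 1 - i)"
    if "1 \<le> i" "i < j" "j \<le> n" "reversal n \<pi> i > reversal n \<pi> j" for i j
  proof -
    have "n + 1 - \<pi> (n + 1 - j) < n + 1 - \<pi> (n + 1 - i)" using that by (simp add: reversal_def)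
    then show ?thesis by arith
  qed
  have flip': "reversal n \<pi> (n + 1 - j) > reversal n \<pi> (n + 1 - i)"
    if "1 \<le> i" "i < j" "j \<le> n" "\<pi> i > \<pi> j" for i j
  proof -
    have "i \<in> {1..n}" "j \<in> {1..n}" using that by auto
    from perms_range[OF assms this(1)] perms_range[OF assms this(2)] that
    show ?thesis by (auto simp: reversal_def)
  qed
  have "bij_betw ?m {(i, j). 1 \<le> i \<and> i < j \<and> j \<le> n \<and> reversal n \<pi> i > reversal n \<pi> j}
      {(i, j). 1 \<le> i \<and> i < j \<and> j \<le> n \<and> \<pi> i > \<pi> j}"
  proof (rule bij_betwI[where g = ?m])
    show "?m \<in> {(i, j). 1 \<le> i \<and> i < j \<and> j \<le> n \<and> reversal n \<pi> i > reversal n \<pi> j} \<rightarrow>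
      {(i, j). 1 \<le> i \<and> i < j \<and> j \<le> n \<and> \<pi> i > \<pi> j}"
    proof (rule Pi_I)
      fix x assume "x \<in> {(i, j). 1 \<le> i \<and> i < j \<and> j \<le> n \<and> reversal n \<pi> i > reversal n \<pi> j}"
      then obtain i j where x: "x = (i, j)" "1 \<le> i" "i < j" "j \<le> n" "reversal n \<pi> i > reversal n \<pi> j" by auto
      from flip[OF x(2-5)] show "?m x \<in> {(i, j). 1 \<le> i \<and> i < j \<and> j \<le> n \<and> \<pi> i > \<pi> j}"
        using x(1-4) by auto
    qed
    show "?m \<in> {(i, j). 1 \<le> i \<and> i < j \<and> j \<le> n \<and> \<pi> i > \<pi> j} \<rightarrow>
      {(i, j). 1 \<le> i \<and> i < j \<and> j \<le> n \<and> reversal n \<pi> i > reversal n \<pi> j}"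
    proof (rule Pi_I)
      fix x assume "x \<in> {(i, j). 1 \<le> i \<and> i < j \<and> j \<le> n \<and> \<pi> i > \<pi> j}"
      then obtain i j where x: "x = (i, j)" "1 \<le> i" "i < j" "j \<le> n" "\<pi> i > \<pi> j" by auto
      from flip'[OF x(2-5)] show "?m x \<in> {(i, j). 1 \<le> i \<and> i < j \<and> j \<le> n \<and> reversal n \<pi> i > reversal n \<pi> j}"
        using x(1-4) by auto
    qed
  qed auto
  then show ?thesis unfolding inv_count_def by (rule bij_betw_same_card)
qed

lemma (in mallows_param) map_reversal_mallows: "map_pmf (reversal n) (mallows n q) = mallows n q"
proof (rule pmf_eqI)
  fix \<pi>
  have supp: "set_pmf (mallows n q) \<subseteq> perms n" by (auto simp: set_pmf_eq pmf_mallows[OF q0])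
  show "pmf (map_pmf (reversal n) (mallows n q)) \<pi> = pmf (mallows n q) \<pi>"
  proof (cases "\<pi> \<in> perms n")
    case True
    have inj: "inj_on (reversal n) (perms n)" by (rule inj_on_inverseI[where g = "reversal n"]) (rule reversal_reversal)
    have "pmf (map_pmf (reversal n) (mallows n q)) (reversal n (reversal n \<pi>)) = pmf (mallows n q) (reversal n \<pi>)"
    proof (cases "reversal n \<pi> \<in> set_pmf (mallows n q)")
      case True
      then show ?thesis by (intro pmf_map_inj inj_on_subset[OF inj supp])
    next
      case False
      have "reversal n (reversal n \<pi>) \<notin> reversal n ` set_pmf (mallows n q)"
      proof
        assume "reversal n (reversal n \<pi>) \<in> reversal n ` set_pmf (mallows n q)"
        then obtain \<rho> where "\<rho> \<in> set_pmf (mallows n q)" "reversal n (reversal n \<pi>) = reversal n \<rho>" by blast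
        then show False using inj_onD[OF inj] supp reversal_perms[OF True] False by blast
      qed
      then show ?thesis using False by (simp add: pmf_map_outside pmf_eq_0_set_pmf)
    qed
    then show ?thesis
      using True reversal_perms[OF True] by (simp add: reversal_reversal pmf_mallows[OF q0] inv_count_reversal)
  next
    case False
    then have "\<pi> \<notin> reversal n ` set_pmf (mallows n q)" using supp reversal_perms by blast
    then show ?thesis using False by (simp add: pmf_map_outside pmf_mallows[OF q0])
  qed
qed

lemma has_arrangement_reversal:
  assumes \<pi>: "\<pi> \<in> perms n" and k: "k + l \<le> n" "k1 + l \<le> n"
    and arr: "has_arrangement l (perms l) k1 k (reversal n \<pi>)"
  shows "has_arrangement l (perms l) (n - l - k1) (n - l - k) \<pi>"
proof -
  obtain \<sigma> where \<sigma>: "\<sigma> \<in> perms l" "\<And>i. i \<in> {1..l} \<Longrightarrow> reversal n \<pi> (k + i) = k1 + \<sigma> i"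
    using arr unfolding has_arrangement_def by blast
  have "\<pi> (n - l - k + i) = n - l - k1 + reversal l \<sigma> i" if i: "i \<in> {1..l}" for i
  proof -
    have j: "l + 1 - i \<in> {1..l}" using i by auto
    have p: "k + (l + 1 - i) \<in> {1..n}" "n + 1 - (k + (l + 1 - i)) = n - l - k + i" using i k by auto
    have "n - l - k + i \<in> {1..n}" using i k by auto
    from perms_range[OF \<pi> this] have P: "\<pi> (n - l - k + i) \<le> n" by simp
    have s: "\<sigma> (l + 1 - i) \<le> l" using perms_range[OF \<sigma>(1) j] by simp
    have e: "n + 1 - \<pi> (n - l - k + i) = k1 + \<sigma> (l + 1 - i)"
      using \<sigma>(2)[OF j] p(1) unfolding reversal_def p(2) by simp
    have r: "reversal l \<sigma> i = l + 1 - \<sigma> (l + 1 - i)" using i by (simp add: reversal_def)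
    show ?thesis unfolding r using e P s k(2) by arith
  qed
  then show ?thesis unfolding has_arrangement_def using reversal_perms[OF \<sigma>(1)] by blast
qed

text \<open>Near the beginning the truncated codes are close to uniform on small sets and closeness of codes is no
longer rare. Reversing positions and values preserves the Mallows law and moves the block to the end,
where the bound for late blocks applies; the pattern changes, hence the passage to all patterns.\<close>

lemma (in mallows_param) prob_block_le_reversed:
  assumes S: "S \<subseteq> perms l" and l: "1 \<le> l" and k: "k + l \<le> n" "q ^ (n - l - k) \<le> 1 / 2"
  shows "measure_pmf.prob (codes q n) {c. block l S k n c} \<le> (8 * real l * (1 - q)) ^ (l - 1)"
proof -
  have supp: "set_pmf (mallows n q) \<subseteq> perms n" by (auto simp: set_pmf_eq pmf_mallows[OF q0])
  let ?M = "measure_pmf.prob (mallows n q)"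
  have k': "n - l - k + l \<le> n" using k by simp
  have full: "measure_pmf.prob (codes q n) {c. block l T j n c} =
      ?M {\<pi>. block l T j n (code n \<pi>)}" for T j
    by (simp add: map_code_mallows[symmetric] vimage_def)
  have "measure_pmf.prob (codes q n) {c. block l S k n c} \<le> measure_pmf.prob (codes q n) {c. block l (perms l) k n c}"
    by (rule prob_codes_mono) (use S in \<open>auto simp: block_def\<close>)
  also have "\<dots> = ?M {\<pi>. block l (perms l) k n (code n \<pi>)}" by (rule full)
  also have "\<dots> = measure_pmf.prob (map_pmf (reversal n) (mallows n q)) {\<pi>. block l (perms l) k n (code n \<pi>)}"
    by (simp only: map_reversal_mallows)
  also have "\<dots> = ?M {\<pi>. block l (perms l) k n (code n (reversal n \<pi>))}"
    by (simp add: vimage_def)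
  also have "\<dots> \<le> ?M {\<pi>. block l (perms l) (n - l - k) n (code n \<pi>)}"
  proof (rule measure_pmf.finite_measure_mono_AE)
    show "AE \<pi> in measure_pmf (mallows n q). \<pi> \<in> {\<pi>. block l (perms l) k n (code n (reversal n \<pi>))} \<longrightarrow>
        \<pi> \<in> {\<pi>. block l (perms l) (n - l - k) n (code n \<pi>)}"
      unfolding AE_measure_pmf_iff
    proof (intro ballI impI CollectI)
      fix \<pi> assume "\<pi> \<in> set_pmf (mallows n q)" and b: "\<pi> \<in> {\<pi>. block l (perms l) k n (code n (reversal n \<pi>))}"
      then have \<pi>: "\<pi> \<in> perms n" using supp by blast
      from b obtain k1 where k1: "k1 + l \<le> n" "has_arrangement l (perms l) k1 k (reversal n \<pi>)"
        using has_arrangement_iff_block[OF reversal_perms[OF \<pi>] subset_refl l k(1)] by blast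
      have "n - l - k1 + l \<le> n" using k1(1) by simp
      then show "block l (perms l) (n - l - k) n (code n \<pi>)"
        using has_arrangement_iff_block[OF \<pi> subset_refl l k'] has_arrangement_reversal[OF \<pi> k(1) k1] by blast
    qed
  qed simp
  also have "\<dots> = measure_pmf.prob (codes q n) {c. block l (perms l) (n - l - k) n c}" by (rule full[symmetric])
  also have "\<dots> \<le> (8 * real l * (1 - q)) ^ (l - 1)"
    using k' l k by (intro prob_block_le) auto
  finally show ?thesis .
qed

section \<open>From local dependence to a Poisson law\<close>

lemma expectation_card:
  assumes "finite K" "finite (set_pmf M)"
  shows "measure_pmf.expectation M (\<lambda>x. real (card {k \<in> K. Q k x})) = (\<Sum>k\<in>K. measure_pmf.prob M {x. Q k x})"
proof -
  have "real (card {k \<in> K. Q k x}) = (\<Sum>k\<in>K. of_bool (Q k x))" for x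
    using assms(1) by (simp add: Int_def)
  then show ?thesis
    using assms(2) by (simp add: integrable_measure_pmf_finite expectation_of_bool)
qed

lemma prob_pos_le_expectation:
  fixes W :: "'a \<Rightarrow> nat"
  assumes "finite (set_pmf M)"
  shows "measure_pmf.prob M {x. W x \<noteq> 0} \<le> measure_pmf.expectation M (\<lambda>x. real (W x))"
proof -
  have "measure_pmf.prob M {x. W x \<noteq> 0} = measure_pmf.expectation M (\<lambda>x. of_bool (W x \<noteq> 0))"
    by (simp only: expectation_of_bool)
  also have "\<dots> \<le> measure_pmf.expectation M (\<lambda>x. real (W x))"
    using assms by (intro integral_mono) (auto simp: integrable_measure_pmf_finite)
  finally show ?thesis .
qed

lemma prob_near_point_mass:
  fixes p r :: "nat pmf"
  assumes "measure_pmf.prob p {k. k \<noteq> 0} \<le> e" "measure_pmf.prob r {k. k \<noteq> 0} \<le> e"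
  shows "\<bar>measure_pmf.prob p A - measure_pmf.prob r A\<bar> \<le> e"
proof -
  have out: "measure_pmf.prob s A \<le> e" if "0 \<notin> A" "measure_pmf.prob s {k. k \<noteq> 0} \<le> e" for s :: "nat pmf" and A
  proof -
    have "measure_pmf.prob s A \<le> measure_pmf.prob s {k. k \<noteq> 0}"
      using that(1) by (intro measure_pmf.finite_measure_mono) (auto intro: gr0I)
    then show ?thesis using that(2) by linarith
  qed
  show ?thesis
  proof (cases "0 \<in> A")
    case False
    then have "measure_pmf.prob p A \<le> e" "measure_pmf.prob r A \<le> e" using out assms by blast+
    then show ?thesis using measure_nonneg[of p A] measure_nonneg[of r A] by linarith
  next
    case True
    then have "measure_pmf.prob p (UNIV - A) \<le> e" "measure_pmf.prob r (UNIV - A) \<le> e" using out assms by blast+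
    have compl: "measure_pmf.prob s (UNIV - A) = 1 - measure_pmf.prob s A" for s :: "nat pmf"
      using measure_pmf.prob_compl[of A s] by simp
    from \<open>measure_pmf.prob p (UNIV - A) \<le> e\<close> \<open>measure_pmf.prob r (UNIV - A) \<le> e\<close>
    show ?thesis
      using compl[of p] compl[of r] measure_pmf.prob_le_1[of p A] measure_pmf.prob_le_1[of r A] by linarith
  qed
qed

text \<open>Replacing \<open>W\<close> by \<open>W'\<close> costs \<open>\<delta>\<close> in probability and leaves a mismatch between the means of at most
\<open>\<delta>\<close>, which enters multiplied by \<open>|E (g (W' + 1))| \<le> (lam' + 1) / lam\<close>. This is \<open>O(sqrt \<delta>)\<close> if
\<open>lam > sqrt \<delta>\<close>; otherwise both laws put mass at least \<open>1 - lam\<close> on 0.\<close>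

lemma poisson_approximation:
  fixes W W' :: "'a \<Rightarrow> nat"
  assumes fin: "finite (set_pmf M)"
    and lam: "lam = measure_pmf.expectation M (\<lambda>x. real (W x))" "lam > 0"
    and lam': "lam' = measure_pmf.expectation M (\<lambda>x. real (W' x))"
    and \<delta>: "0 < \<delta>" "\<delta> \<le> 1" "\<bar>lam - lam'\<bar> \<le> \<delta>" "measure_pmf.prob M {x. W x \<noteq> W' x} \<le> \<delta>"
    and stein: "\<And>g. (\<And>k. \<bar>g (Suc k) - g k\<bar> \<le> 1 / lam) \<Longrightarrow>
      \<bar>measure_pmf.expectation M (\<lambda>x. lam' * g (W' x + 1) - real (W' x) * g (W' x))\<bar> \<le> B"
  shows "\<bar>measure_pmf.prob (map_pmf W M) A - measure_pmf.prob (poisson_pmf lam) A\<bar> \<le> 4 * sqrt \<delta> + B"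
proof -
  have [simp]: "integrable (measure_pmf M) f" for f :: "'a \<Rightarrow> real"
    using fin by (rule integrable_measure_pmf_finite)
  have B0: "B \<ge> 0" using stein[of "\<lambda>_. 0"] lam(2) by simp
  have sq: "\<delta> \<le> sqrt \<delta>" using \<delta>(1,2) by (simp add: real_le_rsqrt power2_eq_square mult_left_le)
  show ?thesis
  proof (cases "lam \<le> sqrt \<delta>")
    case True
    have "measure_pmf.prob (poisson_pmf lam) {k. k \<noteq> 0} = 1 - exp (- lam)"
    proof -
      have "{k. k \<noteq> 0} = UNIV - {0::nat}" by auto
      then show ?thesis
        using measure_pmf.prob_compl[of "{0}" "poisson_pmf lam"] lam(2) by (simp add: measure_pmf_single)
    qed
    also have "\<dots> \<le> lam" using exp_ge_add_one_self[of "- lam"] by simp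
    finally have 1: "measure_pmf.prob (poisson_pmf lam) {k. k \<noteq> 0} \<le> lam" .
    have "measure_pmf.prob (map_pmf W M) {k. k \<noteq> 0} \<le> lam"
      using prob_pos_le_expectation[OF fin, of W] by (simp add: vimage_def lam(1))
    from prob_near_point_mass[OF this 1, of A] show ?thesis using True B0 by simp
  next
    case False
    define g where "g = stein_sol lam A"
    define P where "P = measure_pmf.prob (poisson_pmf lam) A"
    have lip: "\<bar>g (Suc k) - g k\<bar> \<le> 1 / lam" for k
      unfolding g_def by (rule stein_sol_lipschitz[OF lam(2)])
    have g_le: "\<bar>g k\<bar> \<le> real k / lam" for k
      using unit_steps_lipschitz[where g = g and c = "1 / lam", OF lip, of 0 k] by (simp add: g_def stein_sol_def)
    have "measure_pmf.prob M {x. W' x \<in> A} - P =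
        measure_pmf.expectation M (\<lambda>x. of_bool (W' x \<in> A) - P)"
      by (simp add: expectation_of_bool)
    also have "\<dots> = measure_pmf.expectation M (\<lambda>x. lam * g (W' x + 1) - real (W' x) * g (W' x))"
    proof (rule Bochner_Integration.integral_cong[OF refl])
      fix x
      have "indicator A (W' x) = (of_bool (W' x \<in> A) :: real)" by (simp add: indicator_def)
      then show "of_bool (W' x \<in> A) - P = lam * g (W' x + 1) - real (W' x) * g (W' x)"
        using stein_sol_equation[OF lam(2), of A "W' x"] by (simp add: g_def P_def)
    qed
    also have "\<dots> = measure_pmf.expectation M (\<lambda>x. (lam - lam') * g (W' x + 1) +
        (lam' * g (W' x + 1) - real (W' x) * g (W' x)))"
      by (simp add: algebra_simps)
    also have "\<dots> = (lam - lam') * measure_pmf.expectation M (\<lambda>x. g (W' x + 1)) +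
        measure_pmf.expectation M (\<lambda>x. lam' * g (W' x + 1) - real (W' x) * g (W' x))"
      by (subst Bochner_Integration.integral_add) simp_all
    finally have eq: "measure_pmf.prob M {x. W' x \<in> A} - P = \<dots>" .
    have "\<bar>measure_pmf.expectation M (\<lambda>x. g (W' x + 1))\<bar> \<le> measure_pmf.expectation M (\<lambda>x. \<bar>g (W' x + 1)\<bar>)"
      by (rule integral_abs_bound)
    also have "\<dots> \<le> measure_pmf.expectation M (\<lambda>x. (real (W' x) + 1) / lam)"
    proof (rule integral_mono)
      show "\<bar>g (W' x + 1)\<bar> \<le> (real (W' x) + 1) / lam" for x
        using g_le[of "W' x + 1"] by (simp add: add.commute)
    qed simp_all
    also have "\<dots> = (lam' + 1) / lam" by (simp add: lam')
    finally have Eg: "\<bar>measure_pmf.expectation M (\<lambda>x. g (W' x + 1))\<bar> \<le> (lam' + 1) / lam" .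
    have s0: "sqrt \<delta> > 0" using \<delta>(1) by simp
    have lgt: "sqrt \<delta> < lam" using False by simp
    have "\<bar>(lam - lam') * measure_pmf.expectation M (\<lambda>x. g (W' x + 1))\<bar> \<le> \<delta> * ((lam' + 1) / lam)"
      unfolding abs_mult using \<delta>(1,3) Eg by (intro mult_mono) auto
    also have "\<dots> \<le> \<delta> * ((lam + 2) / lam)"
      using \<delta> lam(2) by (intro mult_left_mono divide_right_mono) auto
    also have "\<dots> = \<delta> + 2 * (\<delta> / lam)" using lam(2) by (simp add: field_simps)
    also have "\<dots> \<le> sqrt \<delta> + 2 * (\<delta> / sqrt \<delta>)"
      using \<delta>(1) sq lgt s0 by (intro add_mono mult_left_mono divide_left_mono) auto
    also have "\<delta> / sqrt \<delta> = sqrt \<delta>" using \<delta>(1) by (simp add: real_div_sqrt)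
    finally have b1: "\<bar>(lam - lam') * measure_pmf.expectation M (\<lambda>x. g (W' x + 1))\<bar> \<le> 3 * sqrt \<delta>" by simp
    have b2: "\<bar>measure_pmf.prob M {x. W' x \<in> A} - P\<bar> \<le> 3 * sqrt \<delta> + B"
      unfolding eq using b1 stein[of g, OF lip] by linarith
    have "measure_pmf.prob M {x. W x \<in> A} \<le> measure_pmf.prob M ({x. W' x \<in> A} \<union> {x. W x \<noteq> W' x})"
      "measure_pmf.prob M {x. W' x \<in> A} \<le> measure_pmf.prob M ({x. W x \<in> A} \<union> {x. W x \<noteq> W' x})"
      by (auto intro!: measure_pmf.finite_measure_mono)
    then have "\<bar>measure_pmf.prob M {x. W x \<in> A} - measure_pmf.prob M {x. W' x \<in> A}\<bar> \<le> \<delta>"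
      using measure_Un_le[of "{x. W' x \<in> A}" "measure_pmf M" "{x. W x \<noteq> W' x}"]
        measure_Un_le[of "{x. W x \<in> A}" "measure_pmf M" "{x. W x \<noteq> W' x}"] \<delta>(4)
      unfolding abs_le_iff by simp
    then show ?thesis using b2 sq by (simp add: vimage_def P_def)
  qed
qed

lemma tv_dist_le:
  assumes "\<And>A. \<bar>measure_pmf.prob X A - measure_pmf.prob Y A\<bar> \<le> c"
  shows "0 \<le> tv_dist X Y \<and> tv_dist X Y \<le> c"
proof
  show "tv_dist X Y \<le> c" unfolding tv_dist_def by (rule cSUP_least) (use assms in auto)
  have "bdd_above (range (\<lambda>A. \<bar>measure_pmf.prob X A - measure_pmf.prob Y A\<bar>))"
    using assms by (intro bdd_aboveI2[of _ _ c]) auto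
  from cSUP_upper[OF UNIV_I[of "{}"] this] show "0 \<le> tv_dist X Y" unfolding tv_dist_def by simp
qed

context mallows_param
begin

definition trunc_time :: "nat \<Rightarrow> nat \<Rightarrow> nat \<Rightarrow> nat \<Rightarrow> nat" where
  "trunc_time n l m k = min n (k + l + m)"

lemma trunc_block_depends: "depends_on {k<..k + l + m} (block l S k (trunc_time n l m k))"
  by (rule depends_on_mono[OF block_depends]) (auto simp: trunc_time_def)

lemma trunc_blocks_indep:
  fixes \<phi> :: "nat \<Rightarrow> real" and n l m k :: nat and S :: "(nat \<Rightarrow> nat) set" and F :: "nat set"
  defines "J \<equiv> \<lambda>k. block l S k (trunc_time n l m k)"
  assumes far: "\<And>j. j \<in> F \<Longrightarrow> k + l + m \<le> j \<or> j + l + m \<le> k"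
  shows "measure_pmf.expectation (codes q n) (\<lambda>c. of_bool (J k c) * \<phi> (card {j \<in> F. J j c})) =
    measure_pmf.prob (codes q n) {c. J k c} * measure_pmf.expectation (codes q n) (\<lambda>c. \<phi> (card {j \<in> F. J j c}))"
proof -
  have "depends_on {k<..k + l + m} (\<lambda>c. of_bool (J k c) :: real)"
    unfolding J_def by (rule depends_on_compose[OF trunc_block_depends])
  moreover have "depends_on (- {k<..k + l + m}) (\<lambda>c. \<phi> (card {j \<in> F. J j c}))"
    unfolding depends_on_def
  proof (intro allI impI)
    fix c c' :: "nat \<Rightarrow> nat"
    assume eq: "\<forall>t\<in>- {k<..k + l + m}. c t = c' t"
    have "J j c = J j c'" if "j \<in> F" for j
      unfolding J_def
      by (rule depends_onD[OF trunc_block_depends]) (use eq far[OF that] in auto)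
    then have "{j \<in> F. J j c} = {j \<in> F. J j c'}" by blast
    then show "\<phi> (card {j \<in> F. J j c}) = \<phi> (card {j \<in> F. J j c'})" by simp
  qed
  ultimately show ?thesis
    unfolding expectation_of_bool[symmetric] by (rule expectation_codes_mult)
qed

text \<open>The neighbourhood of \<open>k\<close> consists of the \<open>j\<close> with \<open>|j - k| < l + m\<close>. In the sum over pairs only
the fewer than \<open>2 l\<close> overlapping blocks cost \<open>\<epsilon> ^ l\<close>; two disjoint blocks force closeness in disjoint
sets of codes, so they cost the square of the one-block bound.\<close>

lemma stein_bound_trunc:
  fixes g :: "nat \<Rightarrow> real" and n :: nat
  assumes S: "S \<subseteq> perms l" and l: "1 \<le> l" and m: "q ^ m \<le> 1 / 2"
    and lip: "\<And>k. \<bar>g (Suc k) - g k\<bar> \<le> c"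
  defines "J \<equiv> \<lambda>k. block l S k (trunc_time n l m k)" and "K \<equiv> {k. m \<le> k \<and> k + l \<le> n}"
  shows "\<bar>measure_pmf.expectation (codes q n) (\<lambda>x.
      measure_pmf.expectation (codes q n) (\<lambda>x. real (card {k \<in> K. J k x})) * g (card {k \<in> K. J k x} + 1)
      - real (card {k \<in> K. J k x}) * g (card {k \<in> K. J k x}))\<bar>
    \<le> c * (real (n + 1) * (4 * real (m + l) * ((8 * real l * (1 - q)) ^ (l - 1))\<^sup>2 + 2 * real l * (16 * real l * (1 - q)) ^ l))"
proof -
  define p where "p = (8 * real l * (1 - q)) ^ (l - 1)"
  define p2 where "p2 = (16 * real l * (1 - q)) ^ l"
  have p0: "p \<ge> 0" "p2 \<ge> 0" using q1 by (auto simp: p_def p2_def)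
  define N where "N k = {j. k < j + l + m \<and> j < k + l + m}" for k
  have finK: "finite K" unfolding K_def by (rule finite_subset[of _ "{..n}"]) auto
  have cardK: "card K \<le> n + 1"
  proof -
    have "card K \<le> card {..n}" by (intro card_mono) (auto simp: K_def)
    then show ?thesis by simp
  qed
  have c0: "c \<ge> 0" using lip[of 0] by linarith
  let ?P = "\<lambda>k. measure_pmf.prob (codes q n) {x. J k x}"
  let ?PP = "\<lambda>k j. measure_pmf.prob (codes q n) {x. J k x \<and> J j x}"
  have qk: "q ^ k \<le> 1 / 2" if "k \<in> K" for k
  proof -
    have "q ^ k \<le> q ^ m" using that q0 q1 by (intro power_decreasing) (auto simp: K_def)
    then show ?thesis using m by linarith
  qed
  have tk: "k + l \<le> trunc_time n l m k" if "k \<in> K" for k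
    using that by (auto simp: K_def trunc_time_def)
  have kn: "k + l \<le> n" if "k \<in> K" for k using that by (simp add: K_def)
  have Pk: "?P k \<le> p" if "k \<in> K" for k
    unfolding J_def p_def by (rule prob_block_le[OF S l tk[OF that] kn[OF that] qk[OF that]])
  have PPlt: "?PP k j \<le> p2 * of_bool (j < k + l) + p\<^sup>2" if "k \<in> K" "j \<in> K" "k < j" for k j
  proof (cases "j < k + l")
    case True
    have "?PP k j \<le> p2" unfolding J_def p2_def
      by (rule prob_two_blocks_overlap[OF S tk[OF that(1)] tk[OF that(2)] that(3) True kn[OF that(2)] qk[OF that(1)]])
    then show ?thesis using True by (simp add: add_increasing2)
  next
    case False
    have "?PP k j \<le> p * p" unfolding J_def p_def
      by (rule prob_two_blocks_disjoint[OF S l tk[OF that(1)] tk[OF that(2)] _ kn[OF that(2)] qk[OF that(1)]])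
        (use False in simp)
    then show ?thesis using False by (simp add: power2_eq_square)
  qed
  have PP: "?PP k j \<le> p2 * of_bool (j < k + l \<and> k < j + l) + p\<^sup>2" if "k \<in> K" "j \<in> K" "k \<noteq> j" for k j
  proof (cases "k < j")
    case True
    then show ?thesis using PPlt[OF that(1,2) True] by simp
  next
    case False
    then have "j < k" using that(3) by simp
    have "?PP k j = ?PP j k" by (simp only: conj_commute)
    then show ?thesis using PPlt[OF that(2,1) \<open>j < k\<close>] \<open>j < k\<close> by simp
  qed
  have cardN: "card (K \<inter> N k) \<le> 2 * (m + l)" for k
  proof -
    have "card (K \<inter> N k) \<le> card {k - (m + l)..<k + (m + l)}"
      by (intro card_mono) (auto simp: N_def)
    then show ?thesis by simp
  qed
  have s1: "(\<Sum>j\<in>K \<inter> N k. ?P k * ?P j) \<le> 2 * real (m + l) * p\<^sup>2" if k: "k \<in> K" for k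
  proof -
    have "(\<Sum>j\<in>K \<inter> N k. ?P k * ?P j) \<le> (\<Sum>j\<in>K \<inter> N k. p * p)"
      using Pk k p0 by (intro sum_mono mult_mono) auto
    also have "\<dots> = real (card (K \<inter> N k)) * p\<^sup>2" by (simp add: power2_eq_square)
    also have "\<dots> \<le> real (2 * (m + l)) * p\<^sup>2"
      using cardN[of k] by (intro mult_right_mono) (simp_all only: of_nat_le_iff, simp)
    finally show ?thesis by simp
  qed
  have s2: "(\<Sum>j\<in>K \<inter> N k - {k}. ?PP k j) \<le> 2 * real l * p2 + 2 * real (m + l) * p\<^sup>2" if k: "k \<in> K" for k
  proof -
    have "(\<Sum>j\<in>K \<inter> N k - {k}. ?PP k j) \<le> (\<Sum>j\<in>K \<inter> N k - {k}. p2 * of_bool (j < k + l \<and> k < j + l) + p\<^sup>2)"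
      using PP k by (intro sum_mono) auto
    also have "\<dots> \<le> (\<Sum>j\<in>K \<inter> N k. p2 * of_bool (j < k + l \<and> k < j + l) + p\<^sup>2)"
      using p0 finK by (intro sum_mono2) auto
    also have "\<dots> = p2 * real (card {j \<in> K \<inter> N k. j < k + l \<and> k < j + l}) + real (card (K \<inter> N k)) * p\<^sup>2"
      using finK by (simp only: sum.distrib sum_distrib_left[symmetric] sum_constant)
        (simp add: Int_def)
    also have "\<dots> \<le> p2 * real (2 * l) + real (2 * (m + l)) * p\<^sup>2"
    proof -
      have "card {j \<in> K \<inter> N k. j < k + l \<and> k < j + l} \<le> card {k - l..<k + l}"
        by (intro card_mono) auto
      then have "real (card {j \<in> K \<inter> N k. j < k + l \<and> k < j + l}) \<le> real (2 * l)"
        by (simp only: of_nat_le_iff) simp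
      moreover have "real (card (K \<inter> N k)) \<le> real (2 * (m + l))"
        using cardN[of k] by (simp only: of_nat_le_iff)
      ultimately show ?thesis using p0 by (intro add_mono mult_left_mono mult_right_mono) auto
    qed
    finally show ?thesis by (simp add: mult_ac)
  qed
  have mean: "measure_pmf.expectation (codes q n) (\<lambda>x. real (card {k \<in> K. J k x})) = (\<Sum>k\<in>K. ?P k)"
    by (rule expectation_card[OF finK finite_codes])
  have "\<bar>measure_pmf.expectation (codes q n) (\<lambda>x. (\<Sum>k\<in>K. ?P k) * g (card {k \<in> K. J k x} + 1)
      - real (card {k \<in> K. J k x}) * g (card {k \<in> K. J k x}))\<bar>
    \<le> c * (\<Sum>k\<in>K. (\<Sum>j\<in>K \<inter> N k. ?P k * ?P j) + (\<Sum>j\<in>K \<inter> N k - {k}. ?PP k j))"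
  proof (rule stein_chen_local[where g = g and c = c, OF finite_codes finK _ _ lip])
    show "k \<in> N k" if "k \<in> K" for k using l by (simp add: N_def)
    show "measure_pmf.expectation (codes q n) (\<lambda>x. of_bool (J k x) * \<phi> (card {j \<in> K - N k. J j x})) =
      ?P k * measure_pmf.expectation (codes q n) (\<lambda>x. \<phi> (card {j \<in> K - N k. J j x}))"
      if "k \<in> K" for k and \<phi> :: "nat \<Rightarrow> real"
      unfolding J_def by (rule trunc_blocks_indep) (auto simp: N_def)
  qed
  also have "\<dots> \<le> c * (\<Sum>k\<in>K. 2 * real (m + l) * p\<^sup>2 + (2 * real l * p2 + 2 * real (m + l) * p\<^sup>2))"
    using s1 s2 by (intro mult_left_mono[OF _ c0] sum_mono add_mono) auto
  also have "\<dots> = c * (real (card K) * (4 * real (m + l) * p\<^sup>2 + 2 * real l * p2))"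
    by (simp add: algebra_simps)
  also have "\<dots> \<le> c * (real (n + 1) * (4 * real (m + l) * p\<^sup>2 + 2 * real l * p2))"
    using cardK c0 p0 by (intro mult_left_mono mult_right_mono) auto
  finally show ?thesis unfolding mean p_def p2_def .
qed

end

section \<open>Assembling the bound\<close>

lemma exp_minus_double_le:
  fixes e :: real
  assumes "0 \<le> e" "e \<le> 1 / 2"
  shows "exp (- (2 * e)) \<le> 1 - e"
proof -
  have "exp (- (2 * e)) * (1 + 2 * e) \<le> exp (- (2 * e)) * exp (2 * e)"
    by (intro mult_left_mono exp_ge_add_one_self) auto
  also have "\<dots> = 1" by (simp add: exp_minus)
  also have "1 \<le> (1 - e) * (1 + 2 * e)"
  proof -
    have "0 \<le> e * (1 - 2 * e)" using assms by (intro mult_nonneg_nonneg) auto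
    then show ?thesis by (simp add: algebra_simps)
  qed
  finally show ?thesis using assms by (simp add: mult_le_cancel_right)
qed

context mallows_param
begin

lemma pow_le_exp: "q ^ k \<le> exp (- ((1 - q) * real k))"
proof -
  have "q \<le> exp (- (1 - q))" using exp_ge_add_one_self[of "- (1 - q)"] by simp
  then have "q ^ k \<le> exp (- (1 - q)) ^ k" using q0 by (intro power_mono) auto
  also have "\<dots> = exp (- ((1 - q) * real k))" by (simp add: exp_of_nat_mult[symmetric] algebra_simps)
  finally show ?thesis .
qed

lemma pow_ge_exp:
  assumes "1 - q \<le> 1 / 2"
  shows "exp (- (2 * (1 - q) * real k)) \<le> q ^ k"
proof -
  have "exp (- (2 * (1 - q))) \<le> q" using exp_minus_double_le[of "1 - q"] assms q1 by simp
  then have "exp (- (2 * (1 - q))) ^ k \<le> q ^ k" by (intro power_mono) auto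
  then show ?thesis by (simp add: exp_of_nat_mult[symmetric] algebra_simps)
qed

text \<open>The per-position bound with \<open>m\<close> about \<open>1 / (1 - q)\<close>, for the at least \<open>n / 2\<close> positions that are
far enough from the beginning.\<close>

lemma expectation_blocks_ge:
  assumes S: "S \<noteq> {}" "S \<subseteq> perms l" and l: "1 \<le> l" and e: "1 - q \<le> 1 / 2"
    and n: "4 / (1 - q) + 2 + real l \<le> real n / 2"
  shows "exp (- (real (8 + l) * real l)) / 2 ^ l * real n * (1 - q) ^ (l - 1)
    \<le> measure_pmf.expectation (codes q n) (\<lambda>c. real (card {k \<in> {k. k + l \<le> n}. block l S k n c}))"
proof -
  define e where "e = 1 - q"
  have e0: "0 < e" "e \<le> 1 / 2" using q1 assms(4) by (auto simp: e_def)
  define m where "m = nat \<lceil>1 / e\<rceil>"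
  have m: "1 / e \<le> real m" "real m \<le> 1 / e + 1"
    using e0 by (auto simp: m_def)
  have m1: "1 \<le> m"
  proof -
    have "0 < 1 / e" using e0 by simp
    then have "0 < real m" using m(1) by linarith
    then show ?thesis by simp
  qed
  have em: "1 \<le> e * real m" "e * real m \<le> 2"
  proof -
    show "1 \<le> e * real m" using m(1) e0 by (simp add: field_simps)
    have "e * real m \<le> e * (1 / e + 1)" using m(2) e0 by (intro mult_left_mono) auto
    also have "\<dots> = 1 + e" using e0 by (simp add: field_simps)
    finally show "e * real m \<le> 2" using e0 by simp
  qed
  obtain \<sigma> where \<sigma>: "\<sigma> \<in> S" using S(1) by blast
  define r where "r = ((1 - q) * q ^ (2 * m + l)) ^ l * (1 - q ^ m) ^ (l - 1)"
  have pw: "exp (- real (8 + l)) \<le> q ^ (2 * m + l)"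
  proof -
    have "2 * e * real (2 * m + l) = 4 * (e * real m) + 2 * e * real l" by (simp add: algebra_simps)
    also have "\<dots> \<le> 4 * 2 + 1 * real l" using em e0 by (intro add_mono mult_left_mono mult_right_mono) auto
    finally have "- real (8 + l) \<le> - (2 * e * real (2 * m + l))" by simp
    then have "exp (- real (8 + l)) \<le> exp (- (2 * e * real (2 * m + l)))" by (simp only: exp_le_cancel_iff)
    also have "\<dots> \<le> q ^ (2 * m + l)" unfolding e_def by (rule pow_ge_exp[OF assms(4)])
    finally show ?thesis .
  qed
  have half: "1 / 2 \<le> 1 - q ^ m"
  proof -
    have "q ^ m \<le> exp (- (e * real m))" unfolding e_def by (rule pow_le_exp)
    also have "\<dots> \<le> exp (- 1)" using em by simp
    also have "\<dots> \<le> 1 / 2"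
      using exp_ge_add_one_self[of 1] by (simp add: exp_minus field_simps)
    finally show ?thesis by simp
  qed
  have r_ge: "e ^ l * exp (- (real (8 + l) * real l)) * (1 / 2) ^ (l - 1) \<le> r"
  proof -
    have "exp (- (real (8 + l) * real l)) = exp (- real (8 + l)) ^ l"
      by (simp add: exp_of_nat_mult[symmetric] algebra_simps)
    then have "e ^ l * exp (- (real (8 + l) * real l)) = (e * exp (- real (8 + l))) ^ l"
      by (simp only: power_mult_distrib)
    also have "\<dots> \<le> ((1 - q) * q ^ (2 * m + l)) ^ l"
      using pw e0 unfolding e_def by (intro power_mono mult_left_mono) auto
    finally show ?thesis unfolding r_def
      using half e0 q0 q1 by (intro mult_mono power_mono) auto
  qed
  have r0: "0 \<le> r" unfolding r_def using half q0 q1 by simp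
  have bulk: "real m * r \<le> measure_pmf.prob (codes q n) {c. block l S k n c}" if "2 * m \<le> k" "k + l \<le> n" for k
    unfolding r_def by (rule prob_block_ge[OF \<sigma> S(2) l that(2) m1 that(1)])
  have count: "real n / 2 \<le> real (card {2 * m..n - l})"
  proof -
    have "4 / (1 - q) = 4 * (1 / e)" "0 \<le> 1 / e" using e0 by (simp_all add: e_def)
    then have "2 * real m + real l \<le> real n / 2" using m(2) n by linarith
    then have "real (2 * m + l) \<le> real n / 2" by simp
    then have "2 * m + l \<le> n" "real (2 * m + l) \<le> real n / 2" by auto
    then show ?thesis by (simp add: of_nat_diff)
  qed
  have fin: "finite {k. k + l \<le> n}" by (rule finite_subset[of _ "{..n}"]) auto
  have ln: "l \<le> n"
  proof -
    have "0 \<le> 4 / (1 - q)" using q1 by simp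
    then have "real l \<le> real n" using n by linarith
    then show ?thesis by simp
  qed
  have "exp (- (real (8 + l) * real l)) / 2 ^ l * real n * (1 - q) ^ (l - 1) =
      (real n / 2) * ((1 / e) * (e ^ l * exp (- (real (8 + l) * real l)) * (1 / 2) ^ (l - 1)))"
    using l e0 by (cases l) (simp_all add: e_def field_simps)
  also have "\<dots> \<le> real (card {2 * m..n - l}) * (real m * r)"
    using count m(1) r_ge r0 e0 by (intro mult_mono) auto
  also have "\<dots> = (\<Sum>k\<in>{2 * m..n - l}. real m * r)" by simp
  also have "\<dots> \<le> (\<Sum>k\<in>{2 * m..n - l}. measure_pmf.prob (codes q n) {c. block l S k n c})"
    using ln by (intro sum_mono bulk) auto
  also have "\<dots> \<le> (\<Sum>k\<in>{k. k + l \<le> n}. measure_pmf.prob (codes q n) {c. block l S k n c})"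
    using fin ln by (intro sum_mono2) auto
  also have "\<dots> = measure_pmf.expectation (codes q n) (\<lambda>c. real (card {k \<in> {k. k + l \<le> n}. block l S k n c}))"
    by (rule expectation_card[OF fin finite_codes, symmetric])
  finally show ?thesis .
qed

text \<open>The two counts differ only through a block among the first \<open>m\<close> positions or through a block whose
status changes after its truncation time; the same two sums bound the difference of the means.\<close>

lemma truncation_error:
  fixes n :: nat
  assumes S: "S \<subseteq> perms l" and l: "1 \<le> l" and m: "q ^ m \<le> 1 / 2" and n: "2 * m + l \<le> n"
  defines "W \<equiv> \<lambda>c. card {k \<in> {k. k + l \<le> n}. block l S k n c}"
    and "W' \<equiv> \<lambda>c. card {k \<in> {k. m \<le> k \<and> k + l \<le> n}. block l S k (trunc_time n l m k) c}"
    and "\<delta> \<equiv> real m * (8 * real l * (1 - q)) ^ (l - 1) +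
      real (n + 1) * (real n * real l * (1 / (1 - q) * (1 - (1 - q) / 2) ^ m))"
  shows "measure_pmf.prob (codes q n) {c. W c \<noteq> W' c} \<le> \<delta>"
    and "\<bar>measure_pmf.expectation (codes q n) (\<lambda>c. real (W c)) - measure_pmf.expectation (codes q n) (\<lambda>c. real (W' c))\<bar> \<le> \<delta>"
proof -
  let ?P = "measure_pmf.prob (codes q n)"
  define I where "I k = block l S k n" for k
  define J where "J k = block l S k (trunc_time n l m k)" for k
  define A where "A = {k. k + l \<le> n}"
  define K where "K = {k. m \<le> k \<and> k + l \<le> n}"
  define \<eta> where "\<eta> = real n * real l * (1 / (1 - q) * (1 - (1 - q) / 2) ^ m)"
  have fin: "finite A" "finite K"
    by (rule finite_subset[of _ "{..n}"], auto simp: A_def K_def)+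
  have \<eta>0: "0 \<le> \<eta>" unfolding \<eta>_def using q0 q1 by simp
  have AK: "A = {..<m} \<union> K" "{..<m} \<inter> K = {}" using n by (auto simp: A_def K_def)
  have edge: "?P {c. I k c} \<le> (8 * real l * (1 - q)) ^ (l - 1)" if "k < m" for k
  proof -
    have "q ^ (n - l - k) \<le> q ^ m" using q0 q1 that n by (intro power_decreasing) auto
    then have "q ^ (n - l - k) \<le> 1 / 2" using m by linarith
    then show ?thesis unfolding I_def using that n by (intro prob_block_le_reversed S l) auto
  qed
  have diff: "?P {c. J k c \<noteq> I k c} \<le> \<eta>" if "k \<in> K" for k
  proof (cases "k + l + m \<le> n")
    case True
    then have "trunc_time n l m k = k + l + m" by (simp add: trunc_time_def)
    then show ?thesis unfolding I_def J_def \<eta>_def using True by (intro prob_block_changes S l) auto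
  next
    case False
    then have "trunc_time n l m k = n" by (simp add: trunc_time_def)
    then show ?thesis using \<eta>0 by (simp add: I_def J_def)
  qed
  have cardK: "card K \<le> n + 1"
  proof -
    have "card K \<le> card {..n}" by (intro card_mono) (auto simp: K_def)
    then show ?thesis by simp
  qed
  have total: "(\<Sum>k<m. ?P {c. I k c}) + (\<Sum>k\<in>K. ?P {c. J k c \<noteq> I k c}) \<le> \<delta>"
  proof -
    have "(\<Sum>k<m. ?P {c. I k c}) \<le> (\<Sum>k<m. (8 * real l * (1 - q)) ^ (l - 1))"
      by (intro sum_mono edge) auto
    moreover have "(\<Sum>k\<in>K. ?P {c. J k c \<noteq> I k c}) \<le> (\<Sum>k\<in>K. \<eta>)"
      by (intro sum_mono diff)
    moreover have "real (card K) * \<eta> \<le> real (n + 1) * \<eta>"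
      using cardK \<eta>0 by (intro mult_right_mono) auto
    ultimately show ?thesis unfolding \<delta>_def \<eta>_def[symmetric] by simp
  qed
  have sub: "{c. W c \<noteq> W' c} \<subseteq> (\<Union>k\<in>{..<m}. {c. I k c}) \<union> (\<Union>k\<in>K. {c. J k c \<noteq> I k c})"
  proof
    fix c assume c: "c \<in> {c. W c \<noteq> W' c}"
    show "c \<in> (\<Union>k\<in>{..<m}. {c. I k c}) \<union> (\<Union>k\<in>K. {c. J k c \<noteq> I k c})"
    proof (rule ccontr)
      assume "\<not> ?thesis"
      then have "{k \<in> A. I k c} = {k \<in> K. J k c}" unfolding AK(1) by blast
      then have "W c = W' c" unfolding W_def W'_def I_def J_def A_def K_def by simp
      then show False using c by simp
    qed
  qed
  have "?P {c. W c \<noteq> W' c} \<le> ?P ((\<Union>k\<in>{..<m}. {c. I k c}) \<union> (\<Union>k\<in>K. {c. J k c \<noteq> I k c}))"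
    by (rule measure_pmf.finite_measure_mono[OF sub]) simp
  also have "\<dots> \<le> ?P (\<Union>k\<in>{..<m}. {c. I k c}) + ?P (\<Union>k\<in>K. {c. J k c \<noteq> I k c})"
    by (rule measure_Un_le) simp_all
  also have "\<dots> \<le> (\<Sum>k<m. ?P {c. I k c}) + (\<Sum>k\<in>K. ?P {c. J k c \<noteq> I k c})"
    using fin by (intro add_mono measure_pmf.finite_measure_subadditive_finite) auto
  finally show "?P {c. W c \<noteq> W' c} \<le> \<delta>" using total by linarith
  have W: "measure_pmf.expectation (codes q n) (\<lambda>c. real (W c)) = (\<Sum>k\<in>A. ?P {c. I k c})"
    unfolding W_def I_def A_def by (rule expectation_card[OF fin(1)[unfolded A_def] finite_codes])
  have W': "measure_pmf.expectation (codes q n) (\<lambda>c. real (W' c)) = (\<Sum>k\<in>K. ?P {c. J k c})"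
    unfolding W'_def J_def K_def by (rule expectation_card[OF fin(2)[unfolded K_def] finite_codes])
  have PIJ: "\<bar>?P {c. I k c} - ?P {c. J k c}\<bar> \<le> ?P {c. J k c \<noteq> I k c}" for k
  proof -
    have "?P {c. I k c} \<le> ?P ({c. J k c} \<union> {c. J k c \<noteq> I k c})"
      "?P {c. J k c} \<le> ?P ({c. I k c} \<union> {c. J k c \<noteq> I k c})"
      by (intro measure_pmf.finite_measure_mono; auto)+
    moreover have "?P ({c. J k c} \<union> {c. J k c \<noteq> I k c}) \<le> ?P {c. J k c} + ?P {c. J k c \<noteq> I k c}"
      "?P ({c. I k c} \<union> {c. J k c \<noteq> I k c}) \<le> ?P {c. I k c} + ?P {c. J k c \<noteq> I k c}"
      by (rule measure_Un_le; simp)+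
    ultimately show ?thesis unfolding abs_le_iff by linarith
  qed
  have "(\<Sum>k\<in>A. ?P {c. I k c}) - (\<Sum>k\<in>K. ?P {c. J k c}) =
      (\<Sum>k<m. ?P {c. I k c}) + (\<Sum>k\<in>K. ?P {c. I k c} - ?P {c. J k c})"
    unfolding AK(1) using fin AK(2) by (simp add: sum.union_disjoint sum_subtractf)
  moreover have "\<bar>\<Sum>k\<in>K. ?P {c. I k c} - ?P {c. J k c}\<bar> \<le> (\<Sum>k\<in>K. ?P {c. J k c \<noteq> I k c})"
    by (rule order.trans[OF sum_abs sum_mono]) (rule PIJ)
  moreover have "0 \<le> (\<Sum>k<m. ?P {c. I k c})" by (rule sum_nonneg) simp
  ultimately show "\<bar>measure_pmf.expectation (codes q n) (\<lambda>c. real (W c)) -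
      measure_pmf.expectation (codes q n) (\<lambda>c. real (W' c))\<bar> \<le> \<delta>"
    unfolding W W' using total by linarith
qed

lemma tv_dist_bound:
  fixes n :: nat
  assumes S: "S \<noteq> {}" "S \<subseteq> perms l" and l: "1 \<le> l" and e: "1 - q \<le> 1 / 2"
    and m: "q ^ m \<le> 1 / 2" "2 * m + l \<le> n" and n: "4 / (1 - q) + 2 + real l \<le> real n / 2"
    and lam: "lam = measure_pmf.expectation (mallows n q) (\<lambda>\<pi>. real (Arr n l S \<pi>))"
    and \<delta>: "\<delta> = real m * (8 * real l * (1 - q)) ^ (l - 1) +
      real (n + 1) * (real n * real l * (1 / (1 - q) * (1 - (1 - q) / 2) ^ m))" "\<delta> \<le> 1"
  shows "0 \<le> tv_dist (map_pmf (Arr n l S) (mallows n q)) (poisson_pmf lam) \<and>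
    tv_dist (map_pmf (Arr n l S) (mallows n q)) (poisson_pmf lam) \<le>
    4 * sqrt \<delta> + 2 * (4 * (real m + real l) * ((8 * real l) ^ (l - 1))\<^sup>2 * (1 - q) ^ (l - 1)
      + 2 * real l * (16 * real l) ^ l * (1 - q)) * (2 ^ l * exp (real (8 + l) * real l))"
proof -
  define W where "W c = card {k \<in> {k. k + l \<le> n}. block l S k n c}" for c
  define W' where "W' c = card {k \<in> {k. m \<le> k \<and> k + l \<le> n}. block l S k (trunc_time n l m k) c}" for c
  define lam' where "lam' = measure_pmf.expectation (codes q n) (\<lambda>c. real (W' c))"
  define B where "B = 4 * real (m + l) * ((8 * real l * (1 - q)) ^ (l - 1))\<^sup>2 + 2 * real l * (16 * real l * (1 - q)) ^ l"
  define a where "a = exp (- (real (8 + l) * real l)) / 2 ^ l"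
  have a0: "a > 0" by (simp add: a_def)
  have n0: "real n > 0"
  proof -
    have "0 < 4 / (1 - q)" using q1 by simp
    then show ?thesis using n by linarith
  qed
  have supp: "set_pmf (mallows n q) \<subseteq> perms n" by (auto simp: set_pmf_eq pmf_mallows[OF q0])
  have Arr: "Arr n l S \<pi> = W (code n \<pi>)" if "\<pi> \<in> set_pmf (mallows n q)" for \<pi>
    unfolding W_def using supp that by (intro Arr_eq_card_blocks S l) auto
  have law: "map_pmf (Arr n l S) (mallows n q) = map_pmf W (codes q n)"
    unfolding map_code_mallows[symmetric] pmf.map_comp o_def by (rule map_pmf_cong[OF refl Arr])
  have lamW: "lam = measure_pmf.expectation (codes q n) (\<lambda>c. real (W c))"
  proof -
    have "lam = measure_pmf.expectation (map_pmf (Arr n l S) (mallows n q)) real" by (simp add: lam)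
    also have "\<dots> = measure_pmf.expectation (codes q n) (\<lambda>c. real (W c))" unfolding law by simp
    finally show ?thesis .
  qed
  have lam_ge: "a * real n * (1 - q) ^ (l - 1) \<le> lam"
    unfolding lamW W_def a_def by (rule expectation_blocks_ge[OF S l e n])
  moreover have "0 < a * real n * (1 - q) ^ (l - 1)" using a0 n0 q1 by simp
  ultimately have lam0: "lam > 0" by linarith
  have \<delta>0: "\<delta> > 0"
  proof -
    have "0 < real (n + 1) * (real n * real l * (1 / (1 - q) * (1 - (1 - q) / 2) ^ m))"
      using n0 l q0 q1 by (intro mult_pos_pos) auto
    moreover have "0 \<le> real m * (8 * real l * (1 - q)) ^ (l - 1)" using q1 by simp
    ultimately show ?thesis unfolding \<delta>(1) by linarith
  qed
  have bound: "\<bar>measure_pmf.prob (map_pmf W (codes q n)) A - measure_pmf.prob (poisson_pmf lam) A\<bar>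
      \<le> 4 * sqrt \<delta> + 1 / lam * (real (n + 1) * B)" for A
  proof (rule poisson_approximation[OF finite_codes lamW lam0 lam'_def \<delta>0 \<delta>(2)])
    show "\<bar>lam - lam'\<bar> \<le> \<delta>"
      unfolding lamW lam'_def W_def W'_def \<delta>(1) by (rule truncation_error[OF S(2) l m])
    show "measure_pmf.prob (codes q n) {c. W c \<noteq> W' c} \<le> \<delta>"
      unfolding W_def W'_def \<delta>(1) by (rule truncation_error[OF S(2) l m])
    show "\<bar>measure_pmf.expectation (codes q n) (\<lambda>x. lam' * g (W' x + 1) - real (W' x) * g (W' x))\<bar>
        \<le> 1 / lam * (real (n + 1) * B)" if "\<And>k. \<bar>g (Suc k) - g k\<bar> \<le> 1 / lam" for g
      unfolding lam'_def W'_def B_def by (rule stein_bound_trunc[where g = g and c = "1 / lam", OF S(2) l m(1) that])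
  qed
  have "1 / lam * (real (n + 1) * B) \<le> 1 / (a * real n * (1 - q) ^ (l - 1)) * (2 * real n * B)"
  proof (intro mult_mono)
    show "1 / lam \<le> 1 / (a * real n * (1 - q) ^ (l - 1))"
      using lam_ge \<open>0 < a * real n * (1 - q) ^ (l - 1)\<close> by (intro divide_left_mono) auto
    show "real (n + 1) \<le> 2 * real n" using n0 by simp
    show "0 \<le> B" "0 \<le> 1 / (a * real n * (1 - q) ^ (l - 1))" using q1 a0 by (auto simp: B_def)
    then show "0 \<le> real (n + 1) * B" by simp
  qed simp_all
  also have "\<dots> = 2 * (B / (1 - q) ^ (l - 1)) * (1 / a)" using n0 a0 by (simp add: field_simps)
  also have "B / (1 - q) ^ (l - 1) = 4 * (real m + real l) * ((8 * real l) ^ (l - 1))\<^sup>2 * (1 - q) ^ (l - 1)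
      + 2 * real l * (16 * real l) ^ l * (1 - q)"
  proof -
    obtain j where j: "l = Suc j" using l by (cases l) auto
    define x where "x = (1 - q) ^ j"
    have x: "x > 0" using q1 by (simp add: x_def)
    have "B = 4 * (real m + real l) * ((8 * real l) ^ j)\<^sup>2 * (x * x) + 2 * real l * (16 * real l) ^ l * ((1 - q) * x)"
      unfolding B_def power_mult_distrib by (simp add: j x_def power2_eq_square)
    then show ?thesis using x unfolding j diff_Suc_1 x_def[symmetric] by (simp add: field_simps)
  qed
  also have "1 / a = 2 ^ l * exp (real (8 + l) * real l)" unfolding a_def exp_minus by (simp add: divide_inverse)
  finally have fin: "1 / lam * (real (n + 1) * B) \<le>
    2 * (4 * (real m + real l) * ((8 * real l) ^ (l - 1))\<^sup>2 * (1 - q) ^ (l - 1)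
      + 2 * real l * (16 * real l) ^ l * (1 - q)) * (2 ^ l * exp (real (8 + l) * real l))" .
  show ?thesis unfolding law
    by (rule tv_dist_le) (use bound fin in \<open>meson add_left_mono order.trans\<close>)
qed

end

section \<open>The asymptotic statement\<close>

theorem theorem2p3:
  fixes l :: nat and S :: "(nat \<Rightarrow> nat) set" and q lam :: "nat \<Rightarrow> real"
  assumes "l \<ge> 3"
    and "S \<noteq> {}" and "S \<subseteq> perms l"
    and "\<And>n. q n \<in> {0<..<1}"
    and "(\<lambda>n. real n powr (- (3 / (2 * (real l - 1))))) \<in> o(\<lambda>n. 1 - q n)"
    and "(\<lambda>n. 1 - q n) \<in> o(\<lambda>n. ln (real n) powr (- (1 / (real l - 2))))"
    and "\<And>n. lam n = measure_pmf.expectation (mallows n (q n)) (\<lambda>\<pi>. real (Arr n l S \<pi>))"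
  shows "(\<lambda>n. tv_dist (map_pmf (Arr n l S) (mallows n (q n))) (poisson_pmf (lam n))) \<in> o(\<lambda>n. 1)"
proof -
  define e where "e n = 1 - q n" for n
  \<comment> \<open>The constant 10 turns the contraction \<open>(1 - \<epsilon>/2) ^ m\<close> into \<open>n powr (- 5)\<close>, which beats the factor \<open>n\<^sup>2 / \<epsilon>\<close>.\<close>
  define m where "m n = nat \<lceil>10 * ln (real n) / e n\<rceil>" for n
  have e: "0 < e n" "e n < 1" for n using assms(4)[of n] by (auto simp: e_def)
  have par: "mallows_param (q n)" for n using assms(4)[of n] by unfold_locales auto
  have F1: "(\<lambda>n. e n ^ (l - 2) * ln (real n)) \<longlonglongrightarrow> 0"
  proof -
    have "(\<lambda>n. e n / ln (real n) powr (- (1 / (real l - 2)))) \<longlonglongrightarrow> 0"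
      unfolding e_def by (rule smalloD_tendsto[OF assms(6)])
    then have "(\<lambda>n. (e n / ln (real n) powr (- (1 / (real l - 2)))) ^ (l - 2)) \<longlonglongrightarrow> 0"
      using assms(1) by (intro tendsto_null_power) auto
    moreover have "\<forall>\<^sub>F n in sequentially. (e n / ln (real n) powr (- (1 / (real l - 2)))) ^ (l - 2) = e n ^ (l - 2) * ln (real n)"
      using eventually_gt_at_top[of 2]
    proof eventually_elim
      case (elim n)
      define x where "x = ln (real n)"
      have x: "x > 0" using elim by (simp add: x_def)
      have "(x powr (1 / (real l - 2))) ^ (l - 2) = (x powr (1 / (real l - 2))) powr (real (l - 2))"
        using x by (intro powr_realpow[symmetric]) auto
      also have "\<dots> = x powr (1 / (real l - 2) * real (l - 2))" by (rule powr_powr)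
      also have "1 / (real l - 2) * real (l - 2) = 1" using assms(1) by (simp add: of_nat_diff)
      finally have "(x powr (1 / (real l - 2))) ^ (l - 2) = x" using x by simp
      moreover have "e n / x powr (- (1 / (real l - 2))) = e n * x powr (1 / (real l - 2))"
        unfolding powr_minus_divide by simp
      ultimately show ?case unfolding x_def[symmetric] by (simp only: power_mult_distrib)
    qed
    ultimately show ?thesis by (rule Lim_transform_eventually)
  qed
  have F2: "e \<longlonglongrightarrow> 0"
  proof -
    have "(\<lambda>n. e n / ln (real n) powr (- (1 / (real l - 2)))) \<longlonglongrightarrow> 0"
      unfolding e_def by (rule smalloD_tendsto[OF assms(6)])
    moreover have "(\<lambda>n. ln (real n) powr (- (1 / (real l - 2)))) \<longlonglongrightarrow> 0"
    proof (rule tendsto_neg_powr)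
      show "- (1 / (real l - 2)) < 0" using assms(1) by simp
      show "LIM n sequentially. ln (real n) :> at_top" by real_asymp
    qed
    ultimately have "(\<lambda>n. e n / ln (real n) powr (- (1 / (real l - 2))) * ln (real n) powr (- (1 / (real l - 2)))) \<longlonglongrightarrow> 0 * 0"
      by (rule tendsto_mult)
    moreover have "\<forall>\<^sub>F n in sequentially. e n / ln (real n) powr (- (1 / (real l - 2))) * ln (real n) powr (- (1 / (real l - 2))) = e n"
      using eventually_gt_at_top[of 2] by eventually_elim simp
    ultimately show ?thesis by (simp add: Lim_transform_eventually)
  qed
  \<comment> \<open>As \<open>l \<ge> 3\<close>, the lower bound on \<open>\<epsilon>\<close> is at least \<open>n powr (- 3/4)\<close>, so the range \<open>m\<close> is small compared with \<open>n\<close>.\<close>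
  have E1: "\<forall>\<^sub>F n in sequentially. real n powr (- (3 / 4)) \<le> e n"
  proof -
    have "\<forall>\<^sub>F n in sequentially. norm (real n powr (- (3 / (2 * (real l - 1))))) \<le> 1 * norm (1 - q n)"
      using landau_o.smallD[OF assms(5), of 1] by simp
    then show ?thesis using eventually_ge_at_top[of 1]
    proof eventually_elim
      case (elim n)
      have "3 / (2 * (real l - 1)) \<le> 3 / 4" using assms(1) by (simp add: field_simps)
      then have "real n powr (- (3 / 4)) \<le> real n powr (- (3 / (2 * (real l - 1))))"
        using elim by (intro powr_mono) auto
      then show ?case using elim e[of n] by (simp add: e_def)
    qed
  qed
  have inv: "\<forall>\<^sub>F n in sequentially. 1 / e n \<le> real n powr (3 / 4)"
    using E1 eventually_ge_at_top[of 1]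
  proof eventually_elim
    case (elim n)
    have "1 / e n \<le> 1 / real n powr (- (3 / 4))"
      using elim e[of n] by (intro divide_left_mono) auto
    also have "\<dots> = real n powr (3 / 4)" unfolding powr_minus_divide by simp
    finally show ?case .
  qed
  have m_bounds: "\<forall>\<^sub>F n in sequentially. 10 * ln (real n) \<le> e n * real (m n) \<and> real (m n) \<le> 10 * ln (real n) / e n + 1"
    using eventually_ge_at_top[of 1]
  proof eventually_elim
    case (elim n)
    have nn: "0 \<le> 10 * ln (real n) / e n" using elim e[of n] by simp
    then have "10 * ln (real n) / e n \<le> real (m n)" "real (m n) \<le> 10 * ln (real n) / e n + 1"
      unfolding m_def by linarith+
    then show ?case using e[of n] by (simp add: field_simps)
  qed
  have m_le: "\<forall>\<^sub>F n in sequentially. real (m n) \<le> 10 * ln (real n) * real n powr (3 / 4) + 1"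
    using m_bounds inv eventually_ge_at_top[of 1]
  proof eventually_elim
    case (elim n)
    have "10 * ln (real n) * (1 / e n) \<le> 10 * ln (real n) * real n powr (3 / 4)"
      using elim by (intro mult_left_mono) auto
    then show ?case using elim by simp
  qed
  have G1: "\<forall>\<^sub>F n in sequentially. 2 * m n + l \<le> n"
  proof -
    have "\<forall>\<^sub>F n in sequentially. 2 * (10 * ln (real n) * real n powr (3 / 4) + 1) + real l \<le> real n"
      by real_asymp
    with m_le show ?thesis
    proof eventually_elim
      case (elim n)
      then have "real (2 * m n + l) \<le> real n" by simp
      then show ?case by (simp only: of_nat_le_iff)
    qed
  qed
  have G2: "\<forall>\<^sub>F n in sequentially. 4 / (1 - q n) + 2 + real l \<le> real n / 2"
  proof -
    have "\<forall>\<^sub>F n in sequentially. 4 * real n powr (3 / 4) + 2 + real l \<le> real n / 2"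
      by real_asymp
    with inv show ?thesis by eventually_elim (simp add: e_def)
  qed
  have G3: "\<forall>\<^sub>F n in sequentially. 1 - q n \<le> 1 / 2"
    using order_tendstoD(2)[OF F2, of "1 / 2"] by (auto simp: e_def elim: eventually_mono)
  have G4: "\<forall>\<^sub>F n in sequentially. q n ^ m n \<le> 1 / 2"
    using m_bounds eventually_ge_at_top[of 3]
  proof eventually_elim
    case (elim n)
    interpret mallows_param "q n" by (rule par)
    have "ln (exp 1) \<le> ln (real n)" using elim exp_le by (subst ln_le_cancel_iff) auto
    then have "1 \<le> e n * real (m n)" using elim by simp
    then have "exp (- (e n * real (m n))) \<le> exp (- 1)" by simp
    also have "\<dots> \<le> 1 / 2" using exp_ge_add_one_self[of 1] by (simp add: exp_minus field_simps)
    finally show ?case using pow_le_exp[of "m n"] by (simp add: e_def)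
  qed
  define \<delta> where "\<delta> n = real (m n) * (8 * real l * (1 - q n)) ^ (l - 1) +
      real (n + 1) * (real n * real l * (1 / (1 - q n) * (1 - (1 - q n) / 2) ^ m n))" for n
  have me: "(\<lambda>n. real (m n) * e n ^ (l - 1)) \<longlonglongrightarrow> 0"
  proof (rule tendsto_sandwich[OF _ _ tendsto_const])
    show "\<forall>\<^sub>F n in sequentially. 0 \<le> real (m n) * e n ^ (l - 1)"
      using e by (intro always_eventually allI mult_nonneg_nonneg) (auto intro: less_imp_le)
    show "\<forall>\<^sub>F n in sequentially. real (m n) * e n ^ (l - 1) \<le> 10 * (e n ^ (l - 2) * ln (real n)) + e n ^ (l - 1)"
      using m_bounds
    proof eventually_elim
      case (elim n)
      have l: "l - 1 = Suc (l - 2)" using assms(1) by simp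
      have "real (m n) * e n ^ (l - 1) \<le> (10 * ln (real n) / e n + 1) * e n ^ (l - 1)"
        using elim e[of n] by (intro mult_right_mono) auto
      also have "\<dots> = 10 * (e n ^ (l - 2) * ln (real n)) + e n ^ (l - 1)"
        unfolding l power_Suc using e[of n] by (simp add: field_simps)
      finally show ?case .
    qed
    have "(\<lambda>n. e n ^ (l - 1)) \<longlonglongrightarrow> 0" using F2 assms(1) by (intro tendsto_null_power) auto
    from tendsto_add[OF tendsto_mult_left[OF F1, of 10] this]
    show "(\<lambda>n. 10 * (e n ^ (l - 2) * ln (real n)) + e n ^ (l - 1)) \<longlonglongrightarrow> 0" by simp
  qed
  have \<delta>lim: "\<delta> \<longlonglongrightarrow> 0"
  proof -
    have 1: "(\<lambda>n. (8 * real l) ^ (l - 1) * (real (m n) * e n ^ (l - 1))) \<longlonglongrightarrow> 0"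
      using tendsto_mult_left[OF me, of "(8 * real l) ^ (l - 1)"] by simp
    have 2: "(\<lambda>n. real (n + 1) * (real n * real l * (1 / e n * (1 - e n / 2) ^ m n))) \<longlonglongrightarrow> 0"
    proof (rule tendsto_sandwich[OF _ _ tendsto_const])
      show "\<forall>\<^sub>F n in sequentially. 0 \<le> real (n + 1) * (real n * real l * (1 / e n * (1 - e n / 2) ^ m n))"
      proof (intro always_eventually allI)
        fix n
        show "0 \<le> real (n + 1) * (real n * real l * (1 / e n * (1 - e n / 2) ^ m n))"
          using e[of n] by (intro mult_nonneg_nonneg zero_le_power) auto
      qed
      show "\<forall>\<^sub>F n in sequentially. real (n + 1) * (real n * real l * (1 / e n * (1 - e n / 2) ^ m n))
          \<le> real (n + 1) * (real n * real l * (real n powr (3 / 4) * real n powr (- 5)))"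
        using m_bounds inv eventually_ge_at_top[of 1]
      proof eventually_elim
        case (elim n)
        have "1 - e n / 2 \<le> exp (- (e n / 2))" using exp_ge_add_one_self[of "- (e n / 2)"] by simp
        then have "(1 - e n / 2) ^ m n \<le> exp (- (e n / 2)) ^ m n"
          using e[of n] by (intro power_mono) auto
        also have "\<dots> = exp (- (e n * real (m n)) / 2)" by (simp add: exp_of_nat_mult[symmetric] mult.commute)
        also have "\<dots> \<le> exp (- 5 * ln (real n))" using elim by simp
        also have "\<dots> = real n powr (- 5)" using elim by (simp add: powr_def)
        finally show ?case
          using elim e[of n] by (intro mult_left_mono mult_mono) auto
      qed
      show "(\<lambda>n. real (n + 1) * (real n * real l * (real n powr (3 / 4) * real n powr (- 5)))) \<longlonglongrightarrow> 0"
        by real_asymp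
    qed
    have "\<delta> = (\<lambda>n. (8 * real l) ^ (l - 1) * (real (m n) * e n ^ (l - 1)) +
        real (n + 1) * (real n * real l * (1 / e n * (1 - e n / 2) ^ m n)))"
      by (rule ext) (simp add: \<delta>_def e_def power_mult_distrib)
    then show ?thesis using tendsto_add[OF 1 2] by simp
  qed
  have G5: "\<forall>\<^sub>F n in sequentially. \<delta> n \<le> 1"
    using order_tendstoD(2)[OF \<delta>lim, of 1] by (auto elim: eventually_mono)
  let ?T = "\<lambda>n. tv_dist (map_pmf (Arr n l S) (mallows n (q n))) (poisson_pmf (lam n))"
  let ?R = "\<lambda>n. 4 * sqrt (\<delta> n) + 2 * (4 * (real (m n) + real l) * ((8 * real l) ^ (l - 1))\<^sup>2 * (1 - q n) ^ (l - 1)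
      + 2 * real l * (16 * real l) ^ l * (1 - q n)) * (2 ^ l * exp (real (8 + l) * real l))"
  have bnd: "\<forall>\<^sub>F n in sequentially. 0 \<le> ?T n \<and> ?T n \<le> ?R n"
    using G1 G2 G3 G4 G5
  proof eventually_elim
    case (elim n)
    interpret mallows_param "q n" by (rule par)
    show ?case
      by (rule tv_dist_bound[OF assms(2,3) _ elim(3,4,1,2) assms(7) \<delta>_def elim(5)]) (use assms(1) in simp)
  qed
  have "?T \<longlonglongrightarrow> 0"
  proof (rule tendsto_sandwich[OF _ _ tendsto_const])
    show "\<forall>\<^sub>F n in sequentially. 0 \<le> ?T n" using bnd by eventually_elim simp
    show "\<forall>\<^sub>F n in sequentially. ?T n \<le> ?R n" using bnd by eventually_elim simp
    have e1: "(\<lambda>n. e n ^ (l - 1)) \<longlonglongrightarrow> 0" using F2 assms(1) by (intro tendsto_null_power) auto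
    have "?R = (\<lambda>n. 4 * sqrt (\<delta> n) + 2 * (4 * ((8 * real l) ^ (l - 1))\<^sup>2 * (real (m n) * e n ^ (l - 1) + real l * e n ^ (l - 1))
      + 2 * real l * (16 * real l) ^ l * e n) * (2 ^ l * exp (real (8 + l) * real l)))"
      by (rule ext) (simp add: e_def algebra_simps)
    also have "\<dots> \<longlonglongrightarrow> 4 * sqrt 0 + 2 * (4 * ((8 * real l) ^ (l - 1))\<^sup>2 * (0 + real l * 0)
      + 2 * real l * (16 * real l) ^ l * 0) * (2 ^ l * exp (real (8 + l) * real l))"
      by (intro tendsto_intros \<delta>lim me e1 F2)
    finally show "?R \<longlonglongrightarrow> 0" by simp
  qed
  then show ?thesis by (intro smalloI_tendsto) auto
qed

end
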